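(* Let $n\geq 1$ and let $\mathbb{K}$ be a field. In $\mathbb{K}\mathrm{K}_n$ the following hold: (i) $\{e_X^{(n)}: X\subseteq\{1,\dots,n\}\}=a_n\{e_Y^{(n-1)}: Y\subseteq\{1,\dots,n-1\}\}\ \cup\ \{e_Y^{(n-1)}: Y\subseteq\{1,\dots,n-1\}\}(e-a_n)$. (ii) For every $X\subseteq\{1,\dots,n\}$ the element $e_X^{(n)}$ is a primitive idempotent of $\mathbb{K}\mathrm{K}_n$. (iii) $e_X^{(n)}e_Y^{(n)}=0$ for all $X,Y\subseteq\{1,\dots,n\}$ with $X\neq Y$. (iv) $e=\sum_{X\subseteq\{1,\dots,n\}}e_X^{(n)}$.
   Context: For a positive integer $n$, Kiselman's semigroup $\mathrm{K}_n$ is the monoid (with unit element $e$) given by the monoid presentation with generators $a_1,\dots,a_n$ and relations $a_i^2=a_i$ for $i=1,\dots,n$, and $a_ia_ja_i=a_ja_ia_j=a_ja_i$ for all $1\leq i<j\leq n$. $\mathbb{K}\mathrm{K}_n$ is its semigroup algebra over $\mathbb{K}$. For $m\in\{n-1,n\}$ and $X\subseteq\{1,\dots,m\}$, write $X=\{i_1,\dots,i_s\}$ with $i_1>i_2>\dots>i_s$ and $\{1,\dots,m\}\setminus X=\{j_1,\dots,j_t\}$ with $j_1<j_2<\dots<j_t$, and set $$e_X^{(m)}=a_{i_1}a_{i_2}\cdots a_{i_s}(e-a_{j_1})(e-a_{j_2})\cdots(e-a_{j_t}),$$ where empty products equal $e$ (in particular $e_\varnothing^{(0)}=e$). For $m=n-1$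 this is an element of $\mathbb{K}\mathrm{K}_{n-1}$, regarded as an element of $\mathbb{K}\mathrm{K}_n$ via the embedding $a_i\mapsto a_i$, $1\leq i\leq n-1$. For a set $Z$ and an element $x$ of the algebra, $xZ=\{xz:z\in Z\}$ and $Zx=\{zx:z\in Z\}$. *)

theory Defs
  imports "HOL-Algebra.Ring" "HOL-Library.Poly_Mapping"
begin

section \<open>Monoid presentations\<close>

inductive_set presented_rel :: "'g set \<Rightarrow> ('g list \<times> 'g list) set \<Rightarrow> ('g list \<times> 'g list) set"
  for G :: "'g set" and R :: "('g list \<times> 'g list) set"
where
  refl: "w \<in> lists G \<Longrightarrow> (w, w) \<in> presented_rel G R"
| rel: "(u, v) \<in> R \<Longrightarrow> u \<in> lists G \<Longrightarrow> v \<in> lists G \<Longrightarrow> p \<in> lists G \<Longrightarrow> q \<in> lists G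
    \<Longrightarrow> (p @ u @ q, p @ v @ q) \<in> presented_rel G R"
| sym: "(u, v) \<in> presented_rel G R \<Longrightarrow> (v, u) \<in> presented_rel G R"
| trans: "(u, v) \<in> presented_rel G R \<Longrightarrow> (v, w) \<in> presented_rel G R
    \<Longrightarrow> (u, w) \<in> presented_rel G R"

definition presented_monoid :: "'g set \<Rightarrow> ('g list \<times> 'g list) set \<Rightarrow> 'g list set monoid" where
  "presented_monoid G R =
    \<lparr>carrier = lists G // presented_rel G R,
     mult = (\<lambda>A B. \<Union>u\<in>A. \<Union>v\<in>B. presented_rel G R `` {u @ v}),
     one = presented_rel G R `` {[]}\<rparr>"

lemma presented_rel_lists:
  "(u, v) \<in> presented_rel G R \<Longrightarrow> u \<in> lists G \<and> v \<in> lists G"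
  by (induction rule: presented_rel.induct) auto

lemma presented_rel_append:
  assumes "(u, v) \<in> presented_rel G R" "p \<in> lists G" "q \<in> lists G"
  shows "(p @ u @ q, p @ v @ q) \<in> presented_rel G R"
  using assms
proof (induction rule: presented_rel.induct)
  case (rel u v p' q')
  have "((p @ p') @ u @ (q' @ q), (p @ p') @ v @ (q' @ q)) \<in> presented_rel G R"
    by (rule presented_rel.rel) (use rel in auto)
  then show ?case by simp
next
  case (refl w)
  then show ?case by (intro presented_rel.refl) auto
qed (blast intro: presented_rel.sym presented_rel.trans)+

lemma presented_rel_append2:
  assumes "(u, u') \<in> presented_rel G R" "(v, v') \<in> presented_rel G R"
  shows "(u @ v, u' @ v') \<in> presented_rel G R"
proof -
  have "(u @ v, u' @ v) \<in> presented_rel G R"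
    using presented_rel_append[OF assms(1), of "[]" v] presented_rel_lists[OF assms(2)] by simp
  moreover have "(u' @ v, u' @ v') \<in> presented_rel G R"
    using presented_rel_append[OF assms(2), of u' "[]"] presented_rel_lists[OF assms(1)] by simp
  ultimately show ?thesis by (rule presented_rel.trans)
qed

lemma equiv_presented_rel: "equiv (lists G) (presented_rel G R)"
  by (rule equivI)
    (auto simp: refl_on_def sym_on_def trans_on_def dest: presented_rel_lists
      intro: presented_rel.refl presented_rel.sym presented_rel.trans)

lemma presented_mult_class:
  assumes "u \<in> lists G" "v \<in> lists G"
  shows "presented_rel G R `` {u} \<otimes>\<^bsub>presented_monoid G R\<^esub> presented_rel G R `` {v}
    = presented_rel G R `` {u @ v}"
proof -
  have "congruent2 (presented_rel G R) (presented_rel G R) (\<lambda>u v. presented_rel G R `` {u @ v})"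
    by (intro congruent2I' equiv_class_eq[OF equiv_presented_rel] presented_rel_append2)
  from UN_equiv_class2[OF equiv_presented_rel equiv_presented_rel this assms]
  show ?thesis by (simp add: presented_monoid_def)
qed

lemma monoid_presented_monoid: "monoid (presented_monoid G R)"
proof -
  have car: "carrier (presented_monoid G R) = (\<lambda>w. presented_rel G R `` {w}) ` lists G"
    by (auto simp: presented_monoid_def quotient_def)
  have one: "\<one>\<^bsub>presented_monoid G R\<^esub> = presented_rel G R `` {[]}"
    by (simp add: presented_monoid_def)
  show ?thesis
  proof (rule monoidI)
    fix A B C
    assume "A \<in> carrier (presented_monoid G R)" "B \<in> carrier (presented_monoid G R)"
      "C \<in> carrier (presented_monoid G R)"
    then obtain u v w where *: "u \<in> lists G" "A = presented_rel G R `` {u}"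
        "v \<in> lists G" "B = presented_rel G R `` {v}" "w \<in> lists G" "C = presented_rel G R `` {w}"
      unfolding car by blast
    then have "u @ v \<in> lists G" "v @ w \<in> lists G" by auto
    with * show "A \<otimes>\<^bsub>presented_monoid G R\<^esub> B \<otimes>\<^bsub>presented_monoid G R\<^esub> C
        = A \<otimes>\<^bsub>presented_monoid G R\<^esub> (B \<otimes>\<^bsub>presented_monoid G R\<^esub> C)"
      by (simp only: presented_mult_class append_assoc)
  qed (auto simp: car one presented_mult_class[unfolded in_lists_conv_set]
      simp del: Image_singleton_iff intro!: imageI)
qed


section \<open>Monoid algebras\<close>

definition monoid_algebra :: "('a, 'c) monoid_scheme \<Rightarrow> ('a \<Rightarrow>\<^sub>0 'k::comm_ring_1) ring" where
  "monoid_algebra M =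
    \<lparr>carrier = {f. Poly_Mapping.keys f \<subseteq> carrier M},
     mult = (\<lambda>f g. \<Sum>x\<in>Poly_Mapping.keys f. \<Sum>y\<in>Poly_Mapping.keys g.
       Poly_Mapping.single (x \<otimes>\<^bsub>M\<^esub> y) (Poly_Mapping.lookup f x * Poly_Mapping.lookup g y)),
     one = Poly_Mapping.single \<one>\<^bsub>M\<^esub> 1,
     zero = 0,
     add = (+)\<rparr>"

definition monoid_algebra_map :: "('a \<Rightarrow> 'b) \<Rightarrow> ('a \<Rightarrow>\<^sub>0 'k::comm_ring_1) \<Rightarrow> ('b \<Rightarrow>\<^sub>0 'k)" where
  "monoid_algebra_map \<phi> f =
    (\<Sum>x\<in>Poly_Mapping.keys f. Poly_Mapping.single (\<phi> x) (Poly_Mapping.lookup f x))"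

lemma monoid_algebra_simps:
  "f \<in> carrier (monoid_algebra M) \<longleftrightarrow> Poly_Mapping.keys f \<subseteq> carrier M"
  "\<one>\<^bsub>monoid_algebra M\<^esub> = Poly_Mapping.single \<one>\<^bsub>M\<^esub> 1"
  "\<zero>\<^bsub>monoid_algebra M\<^esub> = 0"
  "f \<oplus>\<^bsub>monoid_algebra M\<^esub> g = f + g"
  by (simp_all add: monoid_algebra_def)

lemma monoid_algebra_mult_superset:
  fixes f g :: "'a \<Rightarrow>\<^sub>0 'k::comm_ring_1"
  assumes "finite S" "Poly_Mapping.keys f \<subseteq> S" "finite T" "Poly_Mapping.keys g \<subseteq> T"
  shows "f \<otimes>\<^bsub>monoid_algebra M\<^esub> g = (\<Sum>x\<in>S. \<Sum>y\<in>T.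
    Poly_Mapping.single (x \<otimes>\<^bsub>M\<^esub> y) (Poly_Mapping.lookup f x * Poly_Mapping.lookup g y))"
proof -
  have "f \<otimes>\<^bsub>monoid_algebra M\<^esub> g = (\<Sum>x\<in>Poly_Mapping.keys f. \<Sum>y\<in>T.
    Poly_Mapping.single (x \<otimes>\<^bsub>M\<^esub> y) (Poly_Mapping.lookup f x * Poly_Mapping.lookup g y))"
    unfolding monoid_algebra_def
    by (simp, intro sum.cong refl sum.mono_neutral_left)
      (use assms in \<open>auto simp: in_keys_iff\<close>)
  also have "\<dots> = (\<Sum>x\<in>S. \<Sum>y\<in>T.
    Poly_Mapping.single (x \<otimes>\<^bsub>M\<^esub> y) (Poly_Mapping.lookup f x * Poly_Mapping.lookup g y))"
    by (rule sum.mono_neutral_left) (use assms in \<open>auto simp: in_keys_iff\<close>)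
  finally show ?thesis .
qed

lemma monoid_algebra_mult_add:
  fixes f g h :: "'a \<Rightarrow>\<^sub>0 'k::comm_ring_1"
  shows "(f + g) \<otimes>\<^bsub>monoid_algebra M\<^esub> h
      = f \<otimes>\<^bsub>monoid_algebra M\<^esub> h + g \<otimes>\<^bsub>monoid_algebra M\<^esub> h"
    and "h \<otimes>\<^bsub>monoid_algebra M\<^esub> (f + g)
      = h \<otimes>\<^bsub>monoid_algebra M\<^esub> f + h \<otimes>\<^bsub>monoid_algebra M\<^esub> g"
proof -
  let ?S = "Poly_Mapping.keys f \<union> Poly_Mapping.keys g" and ?T = "Poly_Mapping.keys h"
  have k: "Poly_Mapping.keys (f + g) \<subseteq> ?S" by (rule Poly_Mapping.keys_add)
  show "(f + g) \<otimes>\<^bsub>monoid_algebra M\<^esub> h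
      = f \<otimes>\<^bsub>monoid_algebra M\<^esub> h + g \<otimes>\<^bsub>monoid_algebra M\<^esub> h"
    using k by (simp add: monoid_algebra_mult_superset[where S = ?S and T = ?T]
      lookup_add ring_distribs single_add sum.distrib)
  show "h \<otimes>\<^bsub>monoid_algebra M\<^esub> (f + g)
      = h \<otimes>\<^bsub>monoid_algebra M\<^esub> f + h \<otimes>\<^bsub>monoid_algebra M\<^esub> g"
    using k by (simp add: monoid_algebra_mult_superset[where S = ?T and T = ?S]
      lookup_add ring_distribs single_add sum.distrib)
qed

lemma monoid_algebra_mult_single:
  "Poly_Mapping.single x a \<otimes>\<^bsub>monoid_algebra M\<^esub> Poly_Mapping.single y b
    = Poly_Mapping.single (x \<otimes>\<^bsub>M\<^esub> y) (a * b :: 'k::comm_ring_1)"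
  by (simp add: monoid_algebra_mult_superset[where S = "{x}" and T = "{y}"])

lemma monoid_algebra_mult_zero:
  "(0 :: 'a \<Rightarrow>\<^sub>0 'k::comm_ring_1) \<otimes>\<^bsub>monoid_algebra M\<^esub> f = 0"
  "f \<otimes>\<^bsub>monoid_algebra M\<^esub> (0 :: 'a \<Rightarrow>\<^sub>0 'k::comm_ring_1) = 0"
  by (simp_all add: monoid_algebra_def)

lemma poly_mapping_sum_singles:
  fixes f :: "'a \<Rightarrow>\<^sub>0 'k::comm_ring_1"
  shows "(\<Sum>x\<in>Poly_Mapping.keys f. Poly_Mapping.single x (Poly_Mapping.lookup f x)) = f"
  by (rule poly_mapping_eqI)
    (simp add: lookup_sum lookup_single when_def in_keys_iff)

lemma monoid_algebra_induct [consumes 1, case_names zero single add]: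
  fixes f :: "'a \<Rightarrow>\<^sub>0 'k::comm_ring_1"
  assumes "Poly_Mapping.keys f \<subseteq> C" and "P 0"
    and "\<And>x a. x \<in> C \<Longrightarrow> P (Poly_Mapping.single x a)"
    and "\<And>f g. P f \<Longrightarrow> P g \<Longrightarrow> P (f + g)"
  shows "P f"
proof -
  have "P (\<Sum>x\<in>S. Poly_Mapping.single x (Poly_Mapping.lookup f x))" if "finite S" "S \<subseteq> C" for S
    using that by (induction S rule: finite_induct) (auto intro: assms)
  from this[of "Poly_Mapping.keys f"] assms(1) show ?thesis
    by (simp add: poly_mapping_sum_singles)
qed

lemma ring_monoid_algebra:
  assumes "monoid M"
  shows "ring (monoid_algebra M :: ('a \<Rightarrow>\<^sub>0 'k::comm_ring_1) ring)"
proof -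
  interpret monoid M by fact
  let ?A = "monoid_algebra M :: ('a \<Rightarrow>\<^sub>0 'k) ring"
  have closed: "f \<otimes>\<^bsub>?A\<^esub> g \<in> carrier ?A"
    if "Poly_Mapping.keys f \<subseteq> carrier M" "Poly_Mapping.keys g \<subseteq> carrier M" for f g
  proof -
    have "Poly_Mapping.keys (f \<otimes>\<^bsub>?A\<^esub> g)
        \<subseteq> (\<Union>x\<in>Poly_Mapping.keys f. \<Union>y\<in>Poly_Mapping.keys g. {x \<otimes>\<^bsub>M\<^esub> y})"
      unfolding monoid_algebra_def
      by (simp, intro order.trans[OF keys_sum] UN_mono order.refl) (auto split: if_splits)
    then show ?thesis using that by (auto simp: monoid_algebra_simps)
  qed
  have add_closed: "Poly_Mapping.keys (f + g) \<subseteq> carrier M"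
    if "Poly_Mapping.keys f \<subseteq> carrier M" "Poly_Mapping.keys g \<subseteq> carrier M" for f g :: "'a \<Rightarrow>\<^sub>0 'k"
    using that Poly_Mapping.keys_add[of f g] by blast
  have assoc: "f \<otimes>\<^bsub>?A\<^esub> g \<otimes>\<^bsub>?A\<^esub> h = f \<otimes>\<^bsub>?A\<^esub> (g \<otimes>\<^bsub>?A\<^esub> h)"
    if "Poly_Mapping.keys f \<subseteq> carrier M" "Poly_Mapping.keys g \<subseteq> carrier M"
      "Poly_Mapping.keys h \<subseteq> carrier M" for f g h
    using that(1)
  proof (induction f rule: monoid_algebra_induct)
    case (single x a)
    note x = this
    show ?case using that(2)
    proof (induction g rule: monoid_algebra_induct)
      case (single y b)
      note y = this
      show ?case using that(3)
        by (induction h rule: monoid_algebra_induct)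
          (simp_all add: monoid_algebra_mult_zero monoid_algebra_mult_add
            monoid_algebra_mult_single m_assoc x y mult.assoc)
    qed (simp_all add: monoid_algebra_mult_zero monoid_algebra_mult_add)
  qed (simp_all add: monoid_algebra_mult_zero monoid_algebra_mult_add)
  have one: "\<one>\<^bsub>?A\<^esub> \<otimes>\<^bsub>?A\<^esub> f = f" "f \<otimes>\<^bsub>?A\<^esub> \<one>\<^bsub>?A\<^esub> = f"
    if "Poly_Mapping.keys f \<subseteq> carrier M" for f
    using that by (induction f rule: monoid_algebra_induct)
      (simp_all add: monoid_algebra_simps monoid_algebra_mult_zero monoid_algebra_mult_add
        monoid_algebra_mult_single)
  show ?thesis
  proof (rule ringI)
    show "abelian_group ?A"
    proof (rule abelian_groupI)
      fix f assume "f \<in> carrier ?A"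
      then show "\<exists>g\<in>carrier ?A. g \<oplus>\<^bsub>?A\<^esub> f = \<zero>\<^bsub>?A\<^esub>"
        by (intro bexI[of _ "- f"]) (auto simp: monoid_algebra_simps)
    qed (auto simp: monoid_algebra_simps add_closed ac_simps)
    show "monoid ?A"
      by (rule monoidI) (use closed assoc one in \<open>auto simp: monoid_algebra_simps\<close>)
  qed (simp_all add: monoid_algebra_simps monoid_algebra_mult_add)
qed

lemma monoid_algebra_map_superset:
  assumes "finite S" "Poly_Mapping.keys f \<subseteq> S"
  shows "monoid_algebra_map \<phi> f
    = (\<Sum>x\<in>S. Poly_Mapping.single (\<phi> x) (Poly_Mapping.lookup f x))"
  unfolding monoid_algebra_map_def
  by (rule sum.mono_neutral_left) (use assms in \<open>auto simp: in_keys_iff\<close>)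

lemma monoid_algebra_map_simps:
  "monoid_algebra_map \<phi> 0 = 0"
  "monoid_algebra_map \<phi> (Poly_Mapping.single x a) = Poly_Mapping.single (\<phi> x) a"
  "monoid_algebra_map \<phi> (f + g) = monoid_algebra_map \<phi> f + monoid_algebra_map \<phi> g"
proof -
  let ?S = "Poly_Mapping.keys f \<union> Poly_Mapping.keys g"
  have "Poly_Mapping.keys (f + g) \<subseteq> ?S" by (rule Poly_Mapping.keys_add)
  then show "monoid_algebra_map \<phi> (f + g) = monoid_algebra_map \<phi> f + monoid_algebra_map \<phi> g"
    by (simp add: monoid_algebra_map_superset[where S = ?S] lookup_add single_add sum.distrib)
  show "monoid_algebra_map \<phi> (Poly_Mapping.single x a) = Poly_Mapping.single (\<phi> x) a"
    by (simp add: monoid_algebra_map_superset[where S = "{x}"])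
qed (simp add: monoid_algebra_map_def)

lemma monoid_algebra_map_hom:
  assumes \<phi>: "\<phi> \<in> hom M N" "\<phi> \<one>\<^bsub>M\<^esub> = \<one>\<^bsub>N\<^esub>"
  shows "monoid_algebra_map \<phi> \<in> ring_hom (monoid_algebra M) (monoid_algebra N)"
proof (rule ring_hom_memI)
  fix f :: "'a \<Rightarrow>\<^sub>0 'k::comm_ring_1" assume f: "f \<in> carrier (monoid_algebra M)"
  then have f': "Poly_Mapping.keys f \<subseteq> carrier M" by (simp add: monoid_algebra_simps)
  have "Poly_Mapping.keys (monoid_algebra_map \<phi> f) \<subseteq> \<phi> ` Poly_Mapping.keys f"
    unfolding monoid_algebra_map_def
    by (rule order.trans[OF keys_sum]) (auto split: if_splits)
  also have "\<dots> \<subseteq> carrier N" using f' \<phi>(1) by (auto simp: hom_def)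
  finally show "monoid_algebra_map \<phi> f \<in> carrier (monoid_algebra N)"
    by (simp add: monoid_algebra_simps)
  fix g :: "'a \<Rightarrow>\<^sub>0 'k" assume "g \<in> carrier (monoid_algebra M)"
  then have g': "Poly_Mapping.keys g \<subseteq> carrier M" by (simp add: monoid_algebra_simps)
  show "monoid_algebra_map \<phi> (f \<oplus>\<^bsub>monoid_algebra M\<^esub> g)
      = monoid_algebra_map \<phi> f \<oplus>\<^bsub>monoid_algebra N\<^esub> monoid_algebra_map \<phi> g"
    by (simp add: monoid_algebra_simps monoid_algebra_map_simps)
  show "monoid_algebra_map \<phi> (f \<otimes>\<^bsub>monoid_algebra M\<^esub> g)
      = monoid_algebra_map \<phi> f \<otimes>\<^bsub>monoid_algebra N\<^esub> monoid_algebra_map \<phi> g"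
    using f'
  proof (induction f rule: monoid_algebra_induct)
    case (single x a)
    note x = this
    show ?case using g'
      by (induction g rule: monoid_algebra_induct)
        (use \<phi>(1) x in \<open>simp_all add: monoid_algebra_mult_zero monoid_algebra_mult_add
          monoid_algebra_mult_single monoid_algebra_map_simps hom_mult\<close>)
  qed (simp_all add: monoid_algebra_mult_zero monoid_algebra_mult_add monoid_algebra_map_simps)
qed (simp add: monoid_algebra_simps monoid_algebra_map_simps \<phi>(2))


section \<open>Primitive idempotents\<close>

definition idempotent :: "('a, 'm) ring_scheme \<Rightarrow> 'a \<Rightarrow> bool" where
  "idempotent R x \<longleftrightarrow> x \<in> carrier R \<and> x \<otimes>\<^bsub>R\<^esub> x = x"

definition primitive_idempotent :: "('a, 'm) ring_scheme \<Rightarrow> 'a \<Rightarrow> bool" where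
  "primitive_idempotent R x \<longleftrightarrow>
    idempotent R x \<and> x \<noteq> \<zero>\<^bsub>R\<^esub> \<and>
    \<not> (\<exists>f g. idempotent R f \<and> idempotent R g \<and> f \<noteq> \<zero>\<^bsub>R\<^esub> \<and> g \<noteq> \<zero>\<^bsub>R\<^esub> \<and>
        f \<otimes>\<^bsub>R\<^esub> g = \<zero>\<^bsub>R\<^esub> \<and> g \<otimes>\<^bsub>R\<^esub> f = \<zero>\<^bsub>R\<^esub> \<and> x = f \<oplus>\<^bsub>R\<^esub> g)"


section \<open>Kiselman's semigroup and its algebra\<close>

definition kiselman_rels :: "nat \<Rightarrow> (nat list \<times> nat list) set" where
  "kiselman_rels n =
    {([i, i], [i]) | i. i \<in> {1..n}} \<union>
    {([i, j, i], [j, i]) | i j. 1 \<le> i \<and> i < j \<and> j \<le> n} \<union>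
    {([j, i, j], [j, i]) | i j. 1 \<le> i \<and> i < j \<and> j \<le> n}"

abbreviation kiselman_cong :: "nat \<Rightarrow> (nat list \<times> nat list) set" where
  "kiselman_cong n \<equiv> presented_rel {1..n} (kiselman_rels n)"

definition kiselman :: "nat \<Rightarrow> nat list set monoid" where
  "kiselman n = presented_monoid {1..n} (kiselman_rels n)"

definition kiselman_algebra :: "nat \<Rightarrow> (nat list set \<Rightarrow>\<^sub>0 'k::comm_ring_1) ring" where
  "kiselman_algebra n = monoid_algebra (kiselman n)"

definition kiselman_gen :: "nat \<Rightarrow> nat \<Rightarrow> (nat list set \<Rightarrow>\<^sub>0 'k::comm_ring_1)" where
  "kiselman_gen n i = Poly_Mapping.single (kiselman_cong n `` {[i]}) 1"

text \<open>
  For \<open>m \<le> n\<close>, a class of words in the generators of \<open>K\<^sub>m\<close> is contained in exactly one class of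
  words in the generators of \<open>K\<^sub>n\<close>, namely its image under the relation defining \<open>K\<^sub>n\<close>; on
  classes of single letters this is \<open>a\<^sub>i \<mapsto> a\<^sub>i\<close>.  The map on algebras is the linear extension.
\<close>

definition kiselman_incl :: "nat \<Rightarrow> nat list set \<Rightarrow> nat list set" where
  "kiselman_incl n C = kiselman_cong n `` C"

definition kiselman_algebra_incl ::
    "nat \<Rightarrow> (nat list set \<Rightarrow>\<^sub>0 'k::comm_ring_1) \<Rightarrow> (nat list set \<Rightarrow>\<^sub>0 'k)" where
  "kiselman_algebra_incl n = monoid_algebra_map (kiselman_incl n)"

definition kiselman_idem :: "nat \<Rightarrow> nat set \<Rightarrow> (nat list set \<Rightarrow>\<^sub>0 'k::comm_ring_1)" where
  "kiselman_idem m X = (let A = kiselman_algebra m in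
    foldr (mult A)
      (map (kiselman_gen m) (rev (sorted_list_of_set X)) @
       map (\<lambda>j. \<one>\<^bsub>A\<^esub> \<ominus>\<^bsub>A\<^esub> kiselman_gen m j) (sorted_list_of_set ({1..m} - X)))
      \<one>\<^bsub>A\<^esub>)"

lemma ring_kiselman_algebra: "ring (kiselman_algebra n)"
  unfolding kiselman_algebra_def kiselman_def
  by (intro ring_monoid_algebra monoid_presented_monoid)

lemma kiselman_cong_mono:
  assumes "m \<le> n" "(u, v) \<in> kiselman_cong m"
  shows "(u, v) \<in> kiselman_cong n"
  using assms(2)
proof (induction rule: presented_rel.induct)
  case (rel u v p q)
  have "(u, v) \<in> kiselman_rels n"
    using rel(1) assms(1) unfolding kiselman_rels_def by auto
  moreover have "lists {1..m} \<subseteq> lists {1..n}" using assms(1) by (intro lists_mono) auto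
  ultimately show ?case using rel by (intro presented_rel.rel) blast+
next
  case (refl w)
  moreover have "lists {1..m} \<subseteq> lists {1..n}" using assms(1) by (intro lists_mono) auto
  ultimately show ?case by (blast intro: presented_rel.refl)
qed (blast intro: presented_rel.sym presented_rel.trans)+

lemma kiselman_incl_class:
  assumes "m \<le> n" "w \<in> lists {1..m}"
  shows "kiselman_incl n (kiselman_cong m `` {w}) = kiselman_cong n `` {w}"
  using assms unfolding kiselman_incl_def
  by (blast intro: presented_rel.refl presented_rel.trans kiselman_cong_mono)

lemma kiselman_algebra_incl_gen:
  assumes "m \<le> n" "i \<in> {1..m}"
  shows "kiselman_algebra_incl n (kiselman_gen m i) = kiselman_gen n i"
  using assms kiselman_incl_class[of m n "[i]"]
  by (simp add: kiselman_algebra_incl_def kiselman_gen_def monoid_algebra_map_simps)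

lemma kiselman_incl_hom:
  assumes "m \<le> n"
  shows "kiselman_incl n \<in> hom (kiselman m) (kiselman n)"
    and "kiselman_incl n \<one>\<^bsub>kiselman m\<^esub> = \<one>\<^bsub>kiselman n\<^esub>"
proof -
  have car: "carrier (kiselman k) = (\<lambda>w. kiselman_cong k `` {w}) ` lists {1..k}" for k
    by (auto simp: kiselman_def presented_monoid_def quotient_def)
  have sub: "w \<in> lists {1..n}" if "w \<in> lists {1..m}" for w
    using that assms by (auto simp: in_lists_conv_set)
  have mult: "kiselman_cong k `` {u} \<otimes>\<^bsub>kiselman k\<^esub> kiselman_cong k `` {v}
      = kiselman_cong k `` {u @ v}" if "u \<in> lists {1..k}" "v \<in> lists {1..k}" for k u v
    using that unfolding kiselman_def by (rule presented_mult_class)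
  show "kiselman_incl n \<in> hom (kiselman m) (kiselman n)"
  proof (rule homI)
    fix A assume "A \<in> carrier (kiselman m)"
    then obtain u where u: "u \<in> lists {1..m}" "A = kiselman_cong m `` {u}"
      unfolding car by blast
    show "kiselman_incl n A \<in> carrier (kiselman n)"
      unfolding u(2) kiselman_incl_class[OF assms u(1)] car using sub[OF u(1)] by blast
    fix B assume "B \<in> carrier (kiselman m)"
    then obtain v where v: "v \<in> lists {1..m}" "B = kiselman_cong m `` {v}"
      unfolding car by blast
    have uv: "u @ v \<in> lists {1..m}" using u(1) v(1) by auto
    show "kiselman_incl n (A \<otimes>\<^bsub>kiselman m\<^esub> B)
        = kiselman_incl n A \<otimes>\<^bsub>kiselman n\<^esub> kiselman_incl n B"
      unfolding u(2) v(2) mult[OF u(1) v(1)] kiselman_incl_class[OF assms uv]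
        kiselman_incl_class[OF assms u(1)] kiselman_incl_class[OF assms v(1)]
        mult[OF sub[OF u(1)] sub[OF v(1)]] ..
  qed
  show "kiselman_incl n \<one>\<^bsub>kiselman m\<^esub> = \<one>\<^bsub>kiselman n\<^esub>"
    using kiselman_incl_class[OF assms, of "[]"] by (simp add: kiselman_def presented_monoid_def)
qed

lemma kiselman_cong_filter:
  assumes "m \<le> n" "(u, v) \<in> kiselman_cong n"
  shows "(filter (\<lambda>i. i \<le> m) u, filter (\<lambda>i. i \<le> m) v) \<in> kiselman_cong m"
  using assms(2)
proof (induction rule: presented_rel.induct)
  case (refl w)
  then show ?case by (intro presented_rel.refl) auto
next
  case (rel u v p q)
  let ?f = "filter (\<lambda>i. i \<le> m)"
  have l: "?f w \<in> lists {1..m}" if "w \<in> lists {1..n}" for w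
    using that by auto
  consider i where "i \<in> {1..n}" "u = [i, i]" "v = [i]"
    | i j where "1 \<le> i" "i < j" "j \<le> n" "u = [i, j, i] \<or> u = [j, i, j]" "v = [j, i]"
    using rel(1) unfolding kiselman_rels_def by blast
  then have "(?f u, ?f v) \<in> kiselman_rels m \<or> ?f u = ?f v"
  proof cases
    case (1 i)
    then show ?thesis by (cases "i \<le> m") (simp_all add: kiselman_rels_def)
  next
    case (2 i j)
    consider "j \<le> m" "i \<le> m" | "\<not> j \<le> m" "i \<le> m" | "\<not> j \<le> m" "\<not> i \<le> m"
      using 2 by linarith
    then show ?thesis
      by cases (use 2 in \<open>auto simp: kiselman_rels_def\<close>)
  qed
  then have "(?f p @ ?f u @ ?f q, ?f p @ ?f v @ ?f q) \<in> kiselman_cong m"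
  proof
    assume "(?f u, ?f v) \<in> kiselman_rels m"
    then show ?thesis by (intro presented_rel.rel l rel)
  next
    assume "?f u = ?f v"
    moreover have "?f p @ ?f v @ ?f q \<in> lists {1..m}" using rel(2-) by auto
    ultimately show ?thesis by (metis presented_rel.refl)
  qed
  then show ?case by simp
qed (blast intro: presented_rel.sym presented_rel.trans)+

lemma kiselman_incl_inj:
  assumes "m \<le> n"
  shows "inj_on (kiselman_incl n) (carrier (kiselman m))"
proof (rule inj_onI)
  fix A B assume A: "A \<in> carrier (kiselman m)" and B: "B \<in> carrier (kiselman m)"
    and eq: "kiselman_incl n A = kiselman_incl n B"
  obtain u v where uv: "u \<in> lists {1..m}" "A = kiselman_cong m `` {u}"
      "v \<in> lists {1..m}" "B = kiselman_cong m `` {v}"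
    using A B unfolding kiselman_def presented_monoid_def by (auto elim!: quotientE)
  have sub: "w \<in> lists {1..n}" if "w \<in> lists {1..m}" for w
    using that assms by (auto simp: in_lists_conv_set)
  have "kiselman_cong n `` {u} = kiselman_cong n `` {v}"
    using eq uv by (simp only: kiselman_incl_class[OF assms])
  then have "(u, v) \<in> kiselman_cong n"
    using eq_equiv_class[OF _ equiv_presented_rel] sub[OF uv(3)] by blast
  moreover have "filter (\<lambda>i. i \<le> m) w = w" if "w \<in> lists {1..m}" for w
    using that by (auto intro: filter_True)
  ultimately have "(u, v) \<in> kiselman_cong m"
    using kiselman_cong_filter[OF assms, of u v] uv(1,3) by (simp only:)
  then show "A = B"
    unfolding uv(2,4) by (rule equiv_class_eq[OF equiv_presented_rel])
qed

lemma kiselman_algebra_incl_hom: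
  assumes "m \<le> n"
  shows "kiselman_algebra_incl n \<in> ring_hom (kiselman_algebra m) (kiselman_algebra n)"
  unfolding kiselman_algebra_incl_def kiselman_algebra_def
  by (rule monoid_algebra_map_hom) (rule kiselman_incl_hom[OF assms])+

end

theory Submission
  imports Defs "HOL-Algebra.UnivPoly"
begin

text \<open>
  Sending \<open>a\<^sub>n\<close> to \<open>0\<close> or to \<open>1\<close> defines two retractions \<open>r0\<close>, \<open>r1\<close> of the algebra of \<open>K\<^sub>n\<close> onto
  that of \<open>K\<^sub>n\<^sub>-\<^sub>1\<close>.  Since \<open>a\<^sub>n w a\<^sub>n = a\<^sub>n w\<close> for every \<open>w\<close>, one has \<open>a\<^sub>n x = a\<^sub>n r1(x)\<close> and
  \<open>x (e - a\<^sub>n) = r0(x) (e - a\<^sub>n)\<close> for every \<open>x\<close>.  With these two rules a complete orthogonal system of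
  idempotents \<open>f\<close> for \<open>K\<^sub>n\<^sub>-\<^sub>1\<close> yields the system of all \<open>a\<^sub>n f\<close> and \<open>f (e - a\<^sub>n)\<close> for \<open>K\<^sub>n\<close>.
  Primitivity is inherited: \<open>r1\<close> maps \<open>g = a\<^sub>n f\<close> to \<open>f\<close> and is injective on \<open>g A g\<close>, where \<open>A\<close> is
  the algebra of \<open>K\<^sub>n\<close>, because \<open>x = g x = a\<^sub>n f r1(x)\<close> there; likewise \<open>r0\<close> for \<open>g = f (e - a\<^sub>n)\<close>.
\<close>


section \<open>Lifting idempotents along a pair of retractions\<close>

lemma (in monoid) foldr_mult_closed:
  "set xs \<subseteq> carrier G \<Longrightarrow> y \<in> carrier G \<Longrightarrow> foldr (\<otimes>) xs y \<in> carrier G"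
  by (induction xs) auto

text \<open>\<open>foldr\<close> nests to the right, so detaching a final factor from a product
  takes associativity. This is how the last factor e - a_n is split off from
  \<open>kiselman_idem\<close>.\<close>

lemma (in monoid) foldr_mult_one:
  "set xs \<subseteq> carrier G \<Longrightarrow> y \<in> carrier G \<Longrightarrow> foldr (\<otimes>) xs y = foldr (\<otimes>) xs \<one> \<otimes> y"
  by (induction xs) (auto simp: foldr_mult_closed m_assoc)

lemma ring_hom_foldr_mult:
  assumes "ring R" "h \<in> ring_hom R S" "set xs \<subseteq> carrier R"
  shows "h (foldr (mult R) xs \<one>\<^bsub>R\<^esub>) = foldr (mult S) (map h xs) \<one>\<^bsub>S\<^esub>"
proof -
  interpret ring R by fact
  show ?thesis
    using assms(3)
    by (induction xs)
      (auto simp: ring_hom_one[OF assms(2)] ring_hom_mult[OF assms(2)] foldr_mult_closed)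
qed

lemma ring_hom_minus:
  assumes "ring R" "ring S" "h \<in> ring_hom R S" "x \<in> carrier R" "y \<in> carrier R"
  shows "h (x \<ominus>\<^bsub>R\<^esub> y) = h x \<ominus>\<^bsub>S\<^esub> h y"
proof -
  interpret ring_hom_ring R S h
    using assms(1-3) by (rule ring_hom_ringI2)
  show ?thesis using assms(4,5) by (simp add: R.minus_eq S.minus_eq)
qed

text \<open>Orthogonal summands f, g of e satisfy e f = f = f e and likewise for g, so both lie in
  the corner e R e. There h kills only zero, so a proper splitting of e would give a proper
  splitting of \<open>h e\<close>.\<close>

lemma primitive_idempotent_lift:
  assumes "ring R" "ring S" and hom: "h \<in> ring_hom R S"
    and e: "idempotent R e" "primitive_idempotent S (h e)"
    and ker: "\<And>x. x \<in> carrier R \<Longrightarrow> e \<otimes>\<^bsub>R\<^esub> x = x \<Longrightarrow> x \<otimes>\<^bsub>R\<^esub> e = x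
      \<Longrightarrow> h x = \<zero>\<^bsub>S\<^esub> \<Longrightarrow> x = \<zero>\<^bsub>R\<^esub>"
  shows "primitive_idempotent R e"
proof -
  interpret R: ring R by fact
  interpret S: ring S by fact
  have zero: "h \<zero>\<^bsub>R\<^esub> = \<zero>\<^bsub>S\<^esub>"
    using hom assms(1,2) by (rule ring_hom_zero)
  have idem: "idempotent S (h x)" if "idempotent R x" for x
    using that ring_hom_closed[OF hom] ring_hom_mult[OF hom, of x x]
    by (auto simp: idempotent_def)
  have "False"
    if f: "idempotent R f" "f \<noteq> \<zero>\<^bsub>R\<^esub>" and g: "idempotent R g" "g \<noteq> \<zero>\<^bsub>R\<^esub>"
      and fg: "f \<otimes>\<^bsub>R\<^esub> g = \<zero>\<^bsub>R\<^esub>" "g \<otimes>\<^bsub>R\<^esub> f = \<zero>\<^bsub>R\<^esub>" "e = f \<oplus>\<^bsub>R\<^esub> g"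
    for f g
  proof -
    have car: "f \<in> carrier R" "g \<in> carrier R"
      using f g by (auto simp: idempotent_def)
    have "f \<otimes>\<^bsub>R\<^esub> f = f" "g \<otimes>\<^bsub>R\<^esub> g = g"
      using f g by (simp_all add: idempotent_def)
    then have "e \<otimes>\<^bsub>R\<^esub> f = f" "f \<otimes>\<^bsub>R\<^esub> e = f" "e \<otimes>\<^bsub>R\<^esub> g = g" "g \<otimes>\<^bsub>R\<^esub> e = g"
      using fg(1,2) car by (simp_all add: fg(3) R.l_distr R.r_distr)
    then have "h f \<noteq> \<zero>\<^bsub>S\<^esub>" "h g \<noteq> \<zero>\<^bsub>S\<^esub>"
      using ker f(2) g(2) car by blast+
    moreover have "h f \<otimes>\<^bsub>S\<^esub> h g = \<zero>\<^bsub>S\<^esub>" "h g \<otimes>\<^bsub>S\<^esub> h f = \<zero>\<^bsub>S\<^esub>"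
      using ring_hom_mult[OF hom car] ring_hom_mult[OF hom car(2,1)] fg zero by auto
    moreover have "h e = h f \<oplus>\<^bsub>S\<^esub> h g"
      using ring_hom_add[OF hom car] fg by simp
    ultimately show False
      using e(2) idem f(1) g(1) unfolding primitive_idempotent_def by blast
  qed
  moreover have "e \<noteq> \<zero>\<^bsub>R\<^esub>"
    using e(2) zero unfolding primitive_idempotent_def by auto
  ultimately show ?thesis
    using e(1) unfolding primitive_idempotent_def by blast
qed

text \<open>R stands for the algebra of K_n, S for that of K_(n-1), \<open>a\<close> for a_n,
  \<open>emb\<close> for the inclusion, and \<open>r0\<close>, \<open>r1\<close> for the evaluations
  of a_n at 0 and 1. Idempotency of \<open>a\<close> is a consequence: take x = a in
  \<open>absorb_left\<close>.\<close>

locale idempotent_doubling = R: ring R + S: ring S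
  for R :: "('a, 'm) ring_scheme" (structure) and S :: "('b, 'l) ring_scheme" (structure) +
  fixes emb :: "'b \<Rightarrow> 'a" and r0 r1 :: "'a \<Rightarrow> 'b" and a :: 'a
  assumes emb: "emb \<in> ring_hom S R"
    and r0: "r0 \<in> ring_hom R S" and r1: "r1 \<in> ring_hom R S"
    and a: "a \<in> carrier R"
    and r0_emb: "y \<in> carrier S \<Longrightarrow> r0 (emb y) = y"
    and r1_emb: "y \<in> carrier S \<Longrightarrow> r1 (emb y) = y"
    and r0_a: "r0 a = \<zero>\<^bsub>S\<^esub>" and r1_a: "r1 a = \<one>\<^bsub>S\<^esub>"
    and absorb_left: "x \<in> carrier R \<Longrightarrow> a \<otimes>\<^bsub>R\<^esub> x = a \<otimes>\<^bsub>R\<^esub> emb (r1 x)"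
    and absorb_right: "x \<in> carrier R
      \<Longrightarrow> x \<otimes>\<^bsub>R\<^esub> (\<one>\<^bsub>R\<^esub> \<ominus>\<^bsub>R\<^esub> a) = emb (r0 x) \<otimes>\<^bsub>R\<^esub> (\<one>\<^bsub>R\<^esub> \<ominus>\<^bsub>R\<^esub> a)"
begin

abbreviation "b \<equiv> \<one>\<^bsub>R\<^esub> \<ominus>\<^bsub>R\<^esub> a"

lemma b: "b \<in> carrier R"
  using a by simp

lemma emb_closed: "y \<in> carrier S \<Longrightarrow> emb y \<in> carrier R"
  by (rule ring_hom_closed[OF emb])

lemma emb_zero: "emb \<zero>\<^bsub>S\<^esub> = \<zero>\<^bsub>R\<^esub>"
  by (rule ring_hom_zero[OF emb S.ring_axioms R.ring_axioms])

lemma emb_mult: "y \<in> carrier S \<Longrightarrow> z \<in> carrier S \<Longrightarrow> emb (y \<otimes>\<^bsub>S\<^esub> z) = emb y \<otimes>\<^bsub>R\<^esub> emb z"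
  by (rule ring_hom_mult[OF emb])

lemma r0_b: "r0 b = \<one>\<^bsub>S\<^esub>"
  using ring_hom_minus[OF R.ring_axioms S.ring_axioms r0 R.one_closed a] r0_a
  by (simp add: ring_hom_one[OF r0] S.minus_eq)

lemma r1_b: "r1 b = \<zero>\<^bsub>S\<^esub>"
  using ring_hom_minus[OF R.ring_axioms S.ring_axioms r1 R.one_closed a] r1_a
  by (simp add: ring_hom_one[OF r1] S.minus_eq S.r_neg)

text \<open>This rule and the next two feed a product containing \<open>a\<close> or
  \<open>b\<close> into an absorption law; the retraction involved then replaces that factor by 0 or
  1.\<close>

lemma a_emb_a: "y \<in> carrier S \<Longrightarrow> a \<otimes>\<^bsub>R\<^esub> (emb y \<otimes>\<^bsub>R\<^esub> a) = a \<otimes>\<^bsub>R\<^esub> emb y"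
  using absorb_left[of "emb y \<otimes>\<^bsub>R\<^esub> a"]
  by (simp add: a emb_closed ring_hom_mult[OF r1] r1_emb r1_a)

lemma a_emb_b: "y \<in> carrier S \<Longrightarrow> a \<otimes>\<^bsub>R\<^esub> (emb y \<otimes>\<^bsub>R\<^esub> b) = \<zero>\<^bsub>R\<^esub>"
  using absorb_left[of "emb y \<otimes>\<^bsub>R\<^esub> b"]
  by (simp add: a b emb_closed ring_hom_mult[OF r1] r1_emb r1_b emb_zero)

lemma b_emb_b: "y \<in> carrier S \<Longrightarrow> b \<otimes>\<^bsub>R\<^esub> (emb y \<otimes>\<^bsub>R\<^esub> b) = emb y \<otimes>\<^bsub>R\<^esub> b"
  using absorb_right[of "b \<otimes>\<^bsub>R\<^esub> emb y"]
  by (simp add: b emb_closed ring_hom_mult[OF r0] r0_emb r0_b R.m_assoc)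

lemma b_a: "b \<otimes>\<^bsub>R\<^esub> a = \<zero>\<^bsub>R\<^esub>"
  \<comment> \<open>At y = 1 the rule reads a a = a, whence (1 - a) a = 0.\<close>
  using a_emb_a[OF S.one_closed] a
  by (simp add: ring_hom_one[OF emb] R.minus_eq R.l_distr R.l_minus R.r_neg)

lemma mult_aa:
  assumes "y \<in> carrier S" "z \<in> carrier S"
  shows "(a \<otimes>\<^bsub>R\<^esub> emb y) \<otimes>\<^bsub>R\<^esub> (a \<otimes>\<^bsub>R\<^esub> emb z) = a \<otimes>\<^bsub>R\<^esub> emb (y \<otimes>\<^bsub>S\<^esub> z)"
proof -
  have "(a \<otimes>\<^bsub>R\<^esub> emb y) \<otimes>\<^bsub>R\<^esub> (a \<otimes>\<^bsub>R\<^esub> emb z) = (a \<otimes>\<^bsub>R\<^esub> (emb y \<otimes>\<^bsub>R\<^esub> a)) \<otimes>\<^bsub>R\<^esub> emb z"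
    using assms by (simp add: a emb_closed R.m_assoc)
  then show ?thesis using assms by (simp add: a_emb_a a emb_closed emb_mult R.m_assoc)
qed

lemma mult_ab:
  assumes "y \<in> carrier S" "z \<in> carrier S"
  shows "(a \<otimes>\<^bsub>R\<^esub> emb y) \<otimes>\<^bsub>R\<^esub> (emb z \<otimes>\<^bsub>R\<^esub> b) = \<zero>\<^bsub>R\<^esub>"
  using a_emb_b[of "y \<otimes>\<^bsub>S\<^esub> z"] assms by (simp add: a b emb_closed emb_mult R.m_assoc)

text \<open>\<open>b\<close> and \<open>a\<close> are adjacent here, so \<open>b_a\<close> suffices.
  In \<open>mult_ab\<close> an embedded element separates them, and absorption has to move past
  it.\<close>

lemma mult_ba:
  assumes "y \<in> carrier S" "z \<in> carrier S"
  shows "(emb y \<otimes>\<^bsub>R\<^esub> b) \<otimes>\<^bsub>R\<^esub> (a \<otimes>\<^bsub>R\<^esub> emb z) = \<zero>\<^bsub>R\<^esub>"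
proof -
  have "(emb y \<otimes>\<^bsub>R\<^esub> b) \<otimes>\<^bsub>R\<^esub> (a \<otimes>\<^bsub>R\<^esub> emb z) = emb y \<otimes>\<^bsub>R\<^esub> ((b \<otimes>\<^bsub>R\<^esub> a) \<otimes>\<^bsub>R\<^esub> emb z)"
    using assms a b emb_closed by (simp only: R.m_assoc R.m_closed)
  then show ?thesis using assms by (simp add: b_a emb_closed)
qed

lemma mult_bb:
  assumes "y \<in> carrier S" "z \<in> carrier S"
  shows "(emb y \<otimes>\<^bsub>R\<^esub> b) \<otimes>\<^bsub>R\<^esub> (emb z \<otimes>\<^bsub>R\<^esub> b) = emb (y \<otimes>\<^bsub>S\<^esub> z) \<otimes>\<^bsub>R\<^esub> b"
  using b_emb_b[of z] assms by (simp add: b emb_closed emb_mult R.m_assoc)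

lemma primitive_a:
  assumes e: "primitive_idempotent S e"
  shows "primitive_idempotent R (a \<otimes>\<^bsub>R\<^esub> emb e)"
proof (rule primitive_idempotent_lift[OF R.ring_axioms S.ring_axioms r1])
  have ec: "e \<in> carrier S" "e \<otimes>\<^bsub>S\<^esub> e = e"
    using e by (auto simp: primitive_idempotent_def idempotent_def)
  show "idempotent R (a \<otimes>\<^bsub>R\<^esub> emb e)"
    using ec mult_aa[of e e] by (simp add: idempotent_def a emb_closed)
  show "primitive_idempotent S (r1 (a \<otimes>\<^bsub>R\<^esub> emb e))"
    using e ec by (simp add: a emb_closed ring_hom_mult[OF r1] r1_a r1_emb)
  fix x assume x: "x \<in> carrier R" "(a \<otimes>\<^bsub>R\<^esub> emb e) \<otimes>\<^bsub>R\<^esub> x = x" "r1 x = \<zero>\<^bsub>S\<^esub>"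
  have "x = a \<otimes>\<^bsub>R\<^esub> (emb e \<otimes>\<^bsub>R\<^esub> x)"
    using x ec by (simp add: a emb_closed R.m_assoc)
  also have "\<dots> = \<zero>\<^bsub>R\<^esub>"
    using absorb_left[of "emb e \<otimes>\<^bsub>R\<^esub> x"] x ec
    by (simp add: a emb_closed ring_hom_mult[OF r1] r1_emb emb_zero)
  finally show "x = \<zero>\<^bsub>R\<^esub>" .
qed

text \<open>Mirror image of \<open>primitive_a\<close>: an element fixed by right multiplication
  with the idempotent ends in \<open>b\<close>, so \<open>absorb_right\<close> determines it by its
  value under \<open>r0\<close>.\<close>

lemma primitive_b:
  assumes e: "primitive_idempotent S e"
  shows "primitive_idempotent R (emb e \<otimes>\<^bsub>R\<^esub> b)"
proof (rule primitive_idempotent_lift[OF R.ring_axioms S.ring_axioms r0])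
  have ec: "e \<in> carrier S" "e \<otimes>\<^bsub>S\<^esub> e = e"
    using e by (auto simp: primitive_idempotent_def idempotent_def)
  show "idempotent R (emb e \<otimes>\<^bsub>R\<^esub> b)"
    using ec mult_bb[of e e] by (simp add: idempotent_def b emb_closed)
  show "primitive_idempotent S (r0 (emb e \<otimes>\<^bsub>R\<^esub> b))"
    using e ec by (simp add: b emb_closed ring_hom_mult[OF r0] r0_b r0_emb)
  fix x assume x: "x \<in> carrier R" "x \<otimes>\<^bsub>R\<^esub> (emb e \<otimes>\<^bsub>R\<^esub> b) = x" "r0 x = \<zero>\<^bsub>S\<^esub>"
  have "x = (x \<otimes>\<^bsub>R\<^esub> emb e) \<otimes>\<^bsub>R\<^esub> b"
    using x ec by (simp add: b emb_closed R.m_assoc)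
  also have "\<dots> = \<zero>\<^bsub>R\<^esub>"
    using absorb_right[of "x \<otimes>\<^bsub>R\<^esub> emb e"] x ec
    by (simp add: b emb_closed ring_hom_mult[OF r0] r0_emb emb_zero)
  finally show "x = \<zero>\<^bsub>R\<^esub>" .
qed

text \<open>Since \<open>emb\<close> maps the given decomposition of 1 to one of 1, distributivity
  collapses the two sums to \<open>b\<close> and \<open>a\<close>, and b + a = 1.\<close>

lemma finsum_doubling:
  assumes "finite I" "f \<in> I \<rightarrow> carrier S" "\<one>\<^bsub>S\<^esub> = (\<Oplus>\<^bsub>S\<^esub>i\<in>I. f i)"
  shows "\<one>\<^bsub>R\<^esub> = (\<Oplus>\<^bsub>R\<^esub>i\<in>I. emb (f i) \<otimes>\<^bsub>R\<^esub> b) \<oplus>\<^bsub>R\<^esub> (\<Oplus>\<^bsub>R\<^esub>i\<in>I. a \<otimes>\<^bsub>R\<^esub> emb (f i))"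
proof -
  interpret h: ring_hom_ring S R emb
    by (rule ring_hom_ringI2[OF S.ring_axioms R.ring_axioms emb])
  have "(\<Oplus>\<^bsub>R\<^esub>i\<in>I. emb (f i)) = \<one>\<^bsub>R\<^esub>"
    using h.hom_finsum[OF assms(2)] assms(3) ring_hom_one[OF emb] by (simp add: comp_def)
  moreover have car: "(\<lambda>i. emb (f i)) \<in> I \<rightarrow> carrier R"
    using assms(2) by (auto simp: Pi_iff emb_closed)
  ultimately have "(\<Oplus>\<^bsub>R\<^esub>i\<in>I. emb (f i) \<otimes>\<^bsub>R\<^esub> b) = b" "(\<Oplus>\<^bsub>R\<^esub>i\<in>I. a \<otimes>\<^bsub>R\<^esub> emb (f i)) = a"
    using R.finsum_ldistr[OF assms(1) b car] R.finsum_rdistr[OF assms(1) a car]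
    by (simp_all add: a b)
  then show ?thesis using a by (simp add: R.minus_eq R.a_assoc R.l_neg)
qed

end


section \<open>Evaluating the last generator at an idempotent scalar\<close>

text \<open>
  Sending a generator to \<open>0\<close> does not come from a monoid homomorphism, hence the scalar weight
  \<open>\<epsilon>\<close> alongside the map \<open>\<phi>\<close> of monoids.
\<close>

definition monoid_algebra_weighted_map ::
    "('a \<Rightarrow> 'b) \<Rightarrow> ('a \<Rightarrow> 'k) \<Rightarrow> ('a \<Rightarrow>\<^sub>0 'k::comm_ring_1) \<Rightarrow> ('b \<Rightarrow>\<^sub>0 'k)" where
  "monoid_algebra_weighted_map \<phi> \<epsilon> f =
    (\<Sum>x\<in>Poly_Mapping.keys f. Poly_Mapping.single (\<phi> x) (\<epsilon> x * Poly_Mapping.lookup f x))"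

lemma monoid_algebra_weighted_map_superset:
  assumes "finite S" "Poly_Mapping.keys f \<subseteq> S"
  shows "monoid_algebra_weighted_map \<phi> \<epsilon> f
    = (\<Sum>x\<in>S. Poly_Mapping.single (\<phi> x) (\<epsilon> x * Poly_Mapping.lookup f x))"
  unfolding monoid_algebra_weighted_map_def
  by (rule sum.mono_neutral_left) (use assms in \<open>auto simp: in_keys_iff\<close>)

lemma monoid_algebra_weighted_map_simps:
  "monoid_algebra_weighted_map \<phi> \<epsilon> 0 = 0"
  "monoid_algebra_weighted_map \<phi> \<epsilon> (Poly_Mapping.single x a) = Poly_Mapping.single (\<phi> x) (\<epsilon> x * a)"
  "monoid_algebra_weighted_map \<phi> \<epsilon> (f + g)
    = monoid_algebra_weighted_map \<phi> \<epsilon> f + monoid_algebra_weighted_map \<phi> \<epsilon> g"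
proof -
  let ?S = "Poly_Mapping.keys f \<union> Poly_Mapping.keys g"
  have "Poly_Mapping.keys (f + g) \<subseteq> ?S" by (rule Poly_Mapping.keys_add)
  then show "monoid_algebra_weighted_map \<phi> \<epsilon> (f + g)
      = monoid_algebra_weighted_map \<phi> \<epsilon> f + monoid_algebra_weighted_map \<phi> \<epsilon> g"
    by (simp add: monoid_algebra_weighted_map_superset[where S = ?S] lookup_add distrib_left
      single_add sum.distrib)
  show "monoid_algebra_weighted_map \<phi> \<epsilon> (Poly_Mapping.single x a)
      = Poly_Mapping.single (\<phi> x) (\<epsilon> x * a)"
    by (simp add: monoid_algebra_weighted_map_superset[where S = "{x}"])
qed (simp add: monoid_algebra_weighted_map_def)

text \<open>Both sides of the product rule are bilinear, so it is enough to compare them on monoid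
  elements, where x goes to \<epsilon>(x) \<phi>(x) and both \<epsilon> and \<phi> are
  multiplicative.\<close>

lemma monoid_algebra_weighted_map_hom:
  fixes \<epsilon> :: "'a \<Rightarrow> 'k::comm_ring_1"
  assumes \<phi>: "\<phi> \<in> hom M N" "\<phi> \<one>\<^bsub>M\<^esub> = \<one>\<^bsub>N\<^esub>"
    and \<epsilon>: "\<And>x y. x \<in> carrier M \<Longrightarrow> y \<in> carrier M \<Longrightarrow> \<epsilon> (x \<otimes>\<^bsub>M\<^esub> y) = \<epsilon> x * \<epsilon> y" "\<epsilon> \<one>\<^bsub>M\<^esub> = 1"
  shows "monoid_algebra_weighted_map \<phi> \<epsilon> \<in> ring_hom (monoid_algebra M) (monoid_algebra N)"
proof (rule ring_hom_memI)
  fix f :: "'a \<Rightarrow>\<^sub>0 'k" assume f: "f \<in> carrier (monoid_algebra M)"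
  then have f': "Poly_Mapping.keys f \<subseteq> carrier M" by (simp add: monoid_algebra_simps)
  have "Poly_Mapping.keys (monoid_algebra_weighted_map \<phi> \<epsilon> f) \<subseteq> \<phi> ` Poly_Mapping.keys f"
    unfolding monoid_algebra_weighted_map_def
    by (rule order.trans[OF keys_sum]) (auto split: if_splits)
  also have "\<dots> \<subseteq> carrier N" using f' \<phi>(1) by (auto simp: hom_def)
  finally show "monoid_algebra_weighted_map \<phi> \<epsilon> f \<in> carrier (monoid_algebra N)"
    by (simp add: monoid_algebra_simps)
  fix g :: "'a \<Rightarrow>\<^sub>0 'k" assume "g \<in> carrier (monoid_algebra M)"
  then have g': "Poly_Mapping.keys g \<subseteq> carrier M" by (simp add: monoid_algebra_simps)
  show "monoid_algebra_weighted_map \<phi> \<epsilon> (f \<oplus>\<^bsub>monoid_algebra M\<^esub> g)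
      = monoid_algebra_weighted_map \<phi> \<epsilon> f \<oplus>\<^bsub>monoid_algebra N\<^esub> monoid_algebra_weighted_map \<phi> \<epsilon> g"
    by (simp add: monoid_algebra_simps monoid_algebra_weighted_map_simps)
  show "monoid_algebra_weighted_map \<phi> \<epsilon> (f \<otimes>\<^bsub>monoid_algebra M\<^esub> g)
      = monoid_algebra_weighted_map \<phi> \<epsilon> f \<otimes>\<^bsub>monoid_algebra N\<^esub> monoid_algebra_weighted_map \<phi> \<epsilon> g"
    using f'
  proof (induction f rule: monoid_algebra_induct)
    case (single x a)
    note x = this
    show ?case using g'
      by (induction g rule: monoid_algebra_induct)
        (use \<phi>(1) x in \<open>simp_all add: monoid_algebra_mult_zero monoid_algebra_mult_add
          monoid_algebra_mult_single monoid_algebra_weighted_map_simps hom_mult \<epsilon> ac_simps\<close>)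
  qed (simp_all add: monoid_algebra_mult_zero monoid_algebra_mult_add
      monoid_algebra_weighted_map_simps)
qed (simp add: monoid_algebra_simps monoid_algebra_weighted_map_simps \<phi>(2) \<epsilon>(2))

section \<open>Words and their classes in Kiselman's semigroup\<close>

lemma carrier_kiselman: "carrier (kiselman n) = (\<lambda>w. kiselman_cong n `` {w}) ` lists {1..n}"
  by (auto simp: kiselman_def presented_monoid_def quotient_def)

lemma one_kiselman: "\<one>\<^bsub>kiselman n\<^esub> = kiselman_cong n `` {[]}"
  by (simp add: kiselman_def presented_monoid_def)

lemma mult_kiselman:
  "u \<in> lists {1..n} \<Longrightarrow> v \<in> lists {1..n} \<Longrightarrow>
    kiselman_cong n `` {u} \<otimes>\<^bsub>kiselman n\<^esub> kiselman_cong n `` {v} = kiselman_cong n `` {u @ v}"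
  unfolding kiselman_def by (rule presented_mult_class)

lemma kiselman_class_eq:
  "(u, v) \<in> kiselman_cong n \<Longrightarrow> kiselman_cong n `` {u} = kiselman_cong n `` {v}"
  by (rule equiv_class_eq[OF equiv_presented_rel])

lemma kiselman_algebra_induct [consumes 1, case_names zero single add]:
  assumes "x \<in> carrier (kiselman_algebra n)" and "P 0"
    and "\<And>w a. w \<in> lists {1..n} \<Longrightarrow> P (Poly_Mapping.single (kiselman_cong n `` {w}) a)"
    and "\<And>f g. P f \<Longrightarrow> P g \<Longrightarrow> P (f + g)"
  shows "P x"
proof -
  have "Poly_Mapping.keys x \<subseteq> carrier (kiselman n)"
    using assms(1) by (simp add: kiselman_algebra_def monoid_algebra_simps)
  then show ?thesis
    by (induction x rule: monoid_algebra_induct) (use assms in \<open>auto simp: carrier_kiselman\<close>)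
qed

lemma kiselman_gen_closed: "i \<in> {1..n} \<Longrightarrow> kiselman_gen n i \<in> carrier (kiselman_algebra n)"
  by (auto simp: kiselman_gen_def kiselman_algebra_def monoid_algebra_simps carrier_kiselman
      intro!: image_eqI[where x = "[i]"])

text \<open>The two sides of each defining relation use the same letters. Hence it is meaningful to
  ask whether a class contains the last generator.\<close>

lemma kiselman_cong_set: "(u, v) \<in> kiselman_cong n \<Longrightarrow> set u = set v"
  by (induction rule: presented_rel.induct) (auto simp: kiselman_rels_def)

lemma kiselman_content_class:
  "w \<in> lists {1..n} \<Longrightarrow> \<Union> (set ` (kiselman_cong n `` {w})) = set w"
  using kiselman_cong_set[of w _ n] presented_rel.refl[of w] by blast

lemma kiselman_absorb_last:
  assumes "w \<in> lists {1..n}" "n \<ge> 1"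
  shows "(n # w @ [n], n # w) \<in> kiselman_cong n"
  using assms(1)
proof (induction w)
  case Nil
  have "([] @ [n, n] @ [], [] @ [n] @ []) \<in> kiselman_cong n"
    by (rule presented_rel.rel) (use assms(2) in \<open>auto simp: kiselman_rels_def\<close>)
  then show ?case by simp
next
  case (Cons i w)
  then have i: "i \<in> {1..n}" and w: "w \<in> lists {1..n}" by auto
  show ?case
  proof (cases "i = n")
    case True
    have "([n] @ (n # w @ [n]) @ [], [n] @ (n # w) @ []) \<in> kiselman_cong n"
      by (rule presented_rel_append) (use Cons.IH assms(2) in auto)
    then show ?thesis using True by simp
  next
    case False
    with i have i: "1 \<le> i" "i < n" by auto
    have rel: "([] @ [n, i, n] @ q, [] @ [n, i] @ q) \<in> kiselman_cong n" if "q \<in> lists {1..n}" for q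
      by (rule presented_rel.rel) (use i that in \<open>auto simp: kiselman_rels_def\<close>)
    \<comment> \<open>Insert a_n behind a_i, use the induction hypothesis on the word starting at
      that new a_n, then remove it again.\<close>
    have "([n, i] @ w @ [n], [n, i, n] @ w @ [n]) \<in> kiselman_cong n"
      using presented_rel.sym[OF rel[of "w @ [n]"]] w assms(2) by simp
    moreover have "([n, i] @ (n # w @ [n]) @ [], [n, i] @ (n # w) @ []) \<in> kiselman_cong n"
      by (rule presented_rel_append) (use Cons.IH i in auto)
    moreover have "([n, i, n] @ w, [n, i] @ w) \<in> kiselman_cong n"
      using rel[OF w] by simp
    ultimately show ?thesis
      by simp (blast intro: presented_rel.trans)
  qed
qed

text \<open>The word form of a_n x = a_n r1(x). The induction runs from the right end, where
  \<open>kiselman_absorb_last\<close> removes a trailing a_n.\<close>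

lemma kiselman_absorb_all:
  assumes "w \<in> lists {1..Suc m}"
  shows "(Suc m # w, Suc m # filter (\<lambda>i. i \<le> m) w) \<in> kiselman_cong (Suc m)"
  using assms
proof (induction w rule: rev_induct)
  case Nil
  show ?case using presented_rel.refl[of "[Suc m]" "{1..Suc m}"] by simp
next
  case (snoc i w)
  then have i: "i \<in> {1..Suc m}" and w: "w \<in> lists {1..Suc m}" by auto
  show ?case
  proof (cases "i = Suc m")
    case True
    then show ?thesis
      using presented_rel.trans[OF kiselman_absorb_last[OF w] snoc.IH[OF w]] by simp
  next
    case False
    then show ?thesis
      using presented_rel_append[OF snoc.IH[OF w], of "[]" "[i]"] i by simp
  qed
qed

text \<open>Apply \<open>kiselman_absorb_last\<close> to the part of w starting at an occurrence of
  n. In the algebra it says that such a word is annihilated by e - a_n on the right.\<close>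

lemma kiselman_absorb_right:
  assumes "w \<in> lists {1..n}" "n \<in> set w"
  shows "(w @ [n], w) \<in> kiselman_cong n"
proof -
  obtain u v where uv: "w = u @ n # v" using assms(2) by (meson split_list)
  have "(u @ (n # v @ [n]) @ [], u @ (n # v) @ []) \<in> kiselman_cong n"
    using assms(1) uv by (intro presented_rel_append kiselman_absorb_last) auto
  then show ?thesis by (simp add: uv)
qed

section \<open>The retractions sending the last generator to 0 or 1\<close>

definition kiselman_delete :: "nat \<Rightarrow> nat list set \<Rightarrow> nat list set" where
  "kiselman_delete m C = kiselman_cong m `` (filter (\<lambda>i. i \<le> m) ` C)"

text \<open>The union collects the letters of all representatives, so no representative has to be
  chosen; by \<open>kiselman_cong_set\<close> each of them has the same letters.\<close>

definition kiselman_weight :: "nat \<Rightarrow> 'k::comm_ring_1 \<Rightarrow> nat list set \<Rightarrow> 'k" where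
  "kiselman_weight m c C = (if Suc m \<in> \<Union> (set ` C) then c else 1)"

text \<open>\<open>c\<close> is the value substituted for a_(m+1): \<open>c = 0\<close> and
  \<open>c = 1\<close> give the retractions r0 and r1.\<close>

definition kiselman_eval :: "nat \<Rightarrow> 'k::comm_ring_1 \<Rightarrow> (nat list set \<Rightarrow>\<^sub>0 'k) \<Rightarrow> (nat list set \<Rightarrow>\<^sub>0 'k)" where
  "kiselman_eval m c = monoid_algebra_weighted_map (kiselman_delete m) (kiselman_weight m c)"

lemma lists_filter_le: "w \<in> lists {1..n} \<Longrightarrow> filter (\<lambda>i. i \<le> m) w \<in> lists {1..m}"
  by auto

text \<open>Deleting the letters above m respects the relations by
  \<open>kiselman_cong_filter\<close>, so the filtered words of one class all lie in a single class
  of K_m.\<close>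

lemma kiselman_delete_class:
  assumes "m \<le> n" "w \<in> lists {1..n}"
  shows "kiselman_delete m (kiselman_cong n `` {w}) = kiselman_cong m `` {filter (\<lambda>i. i \<le> m) w}"
proof -
  have "(w, w) \<in> kiselman_cong n" using assms(2) by (rule presented_rel.refl)
  then show ?thesis
    unfolding kiselman_delete_def
    by (blast intro: presented_rel.trans dest: kiselman_cong_filter[OF assms(1)])
qed

lemma kiselman_weight_class:
  "w \<in> lists {1..n} \<Longrightarrow>
    kiselman_weight m c (kiselman_cong n `` {w}) = (if Suc m \<in> set w then c else 1)"
  by (simp only: kiselman_weight_def kiselman_content_class)

lemma kiselman_eval_single:
  assumes "w \<in> lists {1..Suc m}"
  shows "kiselman_eval m c (Poly_Mapping.single (kiselman_cong (Suc m) `` {w}) x)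
    = Poly_Mapping.single (kiselman_cong m `` {filter (\<lambda>i. i \<le> m) w})
        ((if Suc m \<in> set w then c else 1) * x)"
  unfolding kiselman_eval_def monoid_algebra_weighted_map_simps kiselman_weight_class[OF assms]
    kiselman_delete_class[OF le_SucI[OF order.refl] assms] ..

text \<open>The condition on c is what multiplicativity of the weight demands: if two words both
  contain the last letter, their product has weight c while the weights multiply to c * c.\<close>

lemma kiselman_eval_hom:
  fixes c :: "'k::comm_ring_1"
  assumes "c * c = c"
  shows "kiselman_eval m c \<in> ring_hom (kiselman_algebra (Suc m)) (kiselman_algebra m)"
  unfolding kiselman_eval_def kiselman_algebra_def
proof (rule monoid_algebra_weighted_map_hom)
  have del: "kiselman_delete m (kiselman_cong (Suc m) `` {w})
      = kiselman_cong m `` {filter (\<lambda>i. i \<le> m) w}" if "w \<in> lists {1..Suc m}" for w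
    using that by (rule kiselman_delete_class[OF le_SucI[OF order.refl]])
  show "kiselman_delete m \<in> hom (kiselman (Suc m)) (kiselman m)"
  proof (rule homI)
    fix A assume "A \<in> carrier (kiselman (Suc m))"
    then obtain u where u: "u \<in> lists {1..Suc m}" "A = kiselman_cong (Suc m) `` {u}"
      unfolding carrier_kiselman by blast
    show "kiselman_delete m A \<in> carrier (kiselman m)"
      unfolding u(2) del[OF u(1)] carrier_kiselman using lists_filter_le[OF u(1)] by blast
    fix B assume "B \<in> carrier (kiselman (Suc m))"
    then obtain v where v: "v \<in> lists {1..Suc m}" "B = kiselman_cong (Suc m) `` {v}"
      unfolding carrier_kiselman by blast
    have uv: "u @ v \<in> lists {1..Suc m}" using u(1) v(1) by auto
    show "kiselman_delete m (A \<otimes>\<^bsub>kiselman (Suc m)\<^esub> B)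
        = kiselman_delete m A \<otimes>\<^bsub>kiselman m\<^esub> kiselman_delete m B"
      unfolding u(2) v(2) mult_kiselman[OF u(1) v(1)] del[OF u(1)] del[OF v(1)] del[OF uv]
        mult_kiselman[OF lists_filter_le[OF u(1)] lists_filter_le[OF v(1)]] filter_append ..
  qed
  show "kiselman_delete m \<one>\<^bsub>kiselman (Suc m)\<^esub> = \<one>\<^bsub>kiselman m\<^esub>"
    unfolding one_kiselman using del[of "[]"] by simp
  show "kiselman_weight m c \<one>\<^bsub>kiselman (Suc m)\<^esub> = 1"
    unfolding one_kiselman using kiselman_weight_class[of "[]" "Suc m" m c] by simp
  fix A B assume "A \<in> carrier (kiselman (Suc m))" "B \<in> carrier (kiselman (Suc m))"
  then obtain u v where u: "u \<in> lists {1..Suc m}" "A = kiselman_cong (Suc m) `` {u}"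
    and v: "v \<in> lists {1..Suc m}" "B = kiselman_cong (Suc m) `` {v}"
    unfolding carrier_kiselman by blast
  have uv: "u @ v \<in> lists {1..Suc m}" using u(1) v(1) by auto
  show "kiselman_weight m c (A \<otimes>\<^bsub>kiselman (Suc m)\<^esub> B) = kiselman_weight m c A * kiselman_weight m c B"
    unfolding u(2) v(2) mult_kiselman[OF u(1) v(1)] kiselman_weight_class[OF u(1)]
      kiselman_weight_class[OF v(1)] kiselman_weight_class[OF uv]
    using assms by simp
qed

lemma kiselman_algebra_incl_single:
  assumes "m \<le> n" "w \<in> lists {1..m}"
  shows "kiselman_algebra_incl n (Poly_Mapping.single (kiselman_cong m `` {w}) x)
    = Poly_Mapping.single (kiselman_cong n `` {w}) x"
  unfolding kiselman_algebra_incl_def monoid_algebra_map_simps kiselman_incl_class[OF assms] ..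

lemma kiselman_algebra_incl_zero_add:
  "kiselman_algebra_incl n 0 = 0"
  "kiselman_algebra_incl n (f + g) = kiselman_algebra_incl n f + kiselman_algebra_incl n g"
  by (simp_all add: kiselman_algebra_incl_def monoid_algebra_map_simps)

lemma kiselman_eval_zero_add:
  "kiselman_eval m c 0 = 0"
  "kiselman_eval m c (f + g) = kiselman_eval m c f + kiselman_eval m c g"
  by (simp_all add: kiselman_eval_def monoid_algebra_weighted_map_simps)

lemma kiselman_eval_incl:
  assumes "y \<in> carrier (kiselman_algebra m)"
  shows "kiselman_eval m c (kiselman_algebra_incl (Suc m) y) = y"
  using assms
proof (induction y rule: kiselman_algebra_induct)
  case (single w x)
  then have "w \<in> lists {1..Suc m}" "filter (\<lambda>i. i \<le> m) w = w" "Suc m \<notin> set w"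
    by (auto simp: filter_id_conv)
  with single show ?case
    by (simp only: kiselman_algebra_incl_single le_SucI[OF order.refl] kiselman_eval_single
        if_False mult_1)
qed (simp_all only: kiselman_algebra_incl_zero_add kiselman_eval_zero_add)

lemma kiselman_eval_gen:
  fixes c :: "'k::comm_ring_1"
  shows "kiselman_eval m c (kiselman_gen (Suc m) (Suc m)) = Poly_Mapping.single \<one>\<^bsub>kiselman m\<^esub> c"
  using kiselman_eval_single[of "[Suc m]" m c 1] by (simp add: kiselman_gen_def one_kiselman)

text \<open>Linear extension of \<open>kiselman_absorb_all\<close>. For c = 1 every word has weight
  1, so the evaluation merely deletes the last letter.\<close>

lemma kiselman_absorb_left_algebra:
  assumes "x \<in> carrier (kiselman_algebra (Suc m))"
  shows "kiselman_gen (Suc m) (Suc m) \<otimes>\<^bsub>kiselman_algebra (Suc m)\<^esub> x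
    = kiselman_gen (Suc m) (Suc m) \<otimes>\<^bsub>kiselman_algebra (Suc m)\<^esub>
        kiselman_algebra_incl (Suc m) (kiselman_eval m 1 x)"
  using assms
proof (induction x rule: kiselman_algebra_induct)
  case (single w x)
  let ?w = "filter (\<lambda>i. i \<le> m) w"
  have n: "[Suc m] \<in> lists {1..Suc m}" by simp
  have w': "?w \<in> lists {1..m}" using single by (rule lists_filter_le)
  then have w'': "?w \<in> lists {1..Suc m}" by auto
  have eq: "kiselman_cong (Suc m) `` {[Suc m] @ w} = kiselman_cong (Suc m) `` {[Suc m] @ ?w}"
    using kiselman_class_eq[OF kiselman_absorb_all[OF single]] by (simp only: append.simps)
  show ?case
    unfolding kiselman_eval_single[OF single] if_cancel mult_1
      kiselman_algebra_incl_single[OF le_SucI[OF order.refl] w']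
      kiselman_gen_def kiselman_algebra_def monoid_algebra_mult_single
      mult_kiselman[OF n single] mult_kiselman[OF n w''] eq ..
qed (simp_all only: kiselman_algebra_incl_zero_add kiselman_eval_zero_add
    kiselman_algebra_def monoid_algebra_mult_add)

text \<open>On a word containing the last letter both sides vanish, the left by
  \<open>kiselman_absorb_right\<close> and the right by weight 0. Any other word is returned
  unchanged by evaluation followed by inclusion.\<close>

lemma kiselman_absorb_right_algebra:
  assumes "x \<in> carrier (kiselman_algebra (Suc m))"
  defines "A \<equiv> kiselman_algebra (Suc m)"
  shows "x \<otimes>\<^bsub>A\<^esub> (\<one>\<^bsub>A\<^esub> \<ominus>\<^bsub>A\<^esub> kiselman_gen (Suc m) (Suc m))
    = kiselman_algebra_incl (Suc m) (kiselman_eval m 0 x)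
        \<otimes>\<^bsub>A\<^esub> (\<one>\<^bsub>A\<^esub> \<ominus>\<^bsub>A\<^esub> kiselman_gen (Suc m) (Suc m))"
  using assms(1)
proof (induction x rule: kiselman_algebra_induct)
  case (single w x)
  interpret A: ring A unfolding A_def by (rule ring_kiselman_algebra)
  let ?a = "kiselman_gen (Suc m) (Suc m)" and ?x = "Poly_Mapping.single (kiselman_cong (Suc m) `` {w}) x"
  have a: "?a \<in> carrier A" unfolding A_def by (rule kiselman_gen_closed) simp
  have x: "?x \<in> carrier A"
    using single by (auto simp: A_def kiselman_algebra_def monoid_algebra_simps carrier_kiselman)
  show ?case
  proof (cases "Suc m \<in> set w")
    case True
    have n: "[Suc m] \<in> lists {1..Suc m}" by simp
    have "?x \<otimes>\<^bsub>A\<^esub> ?a = ?x"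
      unfolding A_def kiselman_gen_def kiselman_algebra_def monoid_algebra_mult_single
        mult_kiselman[OF single n] kiselman_class_eq[OF kiselman_absorb_right[OF single True]]
      by simp
    then have "?x \<otimes>\<^bsub>A\<^esub> (\<one>\<^bsub>A\<^esub> \<ominus>\<^bsub>A\<^esub> ?a) = \<zero>\<^bsub>A\<^esub>"
      using a x by (simp add: A.minus_eq A.r_distr A.r_minus A.r_neg)
    moreover have "kiselman_algebra_incl (Suc m) (kiselman_eval m 0 ?x) = \<zero>\<^bsub>A\<^esub>"
      unfolding kiselman_eval_single[OF single]
      by (simp add: True kiselman_algebra_incl_zero_add A_def kiselman_algebra_def
          monoid_algebra_simps)
    ultimately show ?thesis using a by simp
  next
    case False
    then have w: "w \<in> lists {1..m}" and w': "filter (\<lambda>i. i \<le> m) w = w"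
      using single by (auto simp: filter_id_conv le_Suc_eq)
    show ?thesis
      unfolding kiselman_eval_single[OF single] if_not_P[OF False] mult_1 w'
        kiselman_algebra_incl_single[OF le_SucI[OF order.refl] w] ..
  qed
qed (simp_all only: kiselman_algebra_incl_zero_add kiselman_eval_zero_add
    A_def kiselman_algebra_def monoid_algebra_mult_add)

lemma kiselman_doubling:
  "idempotent_doubling (kiselman_algebra (Suc m) :: (nat list set \<Rightarrow>\<^sub>0 'k::comm_ring_1) ring)
    (kiselman_algebra m) (kiselman_algebra_incl (Suc m)) (kiselman_eval m 0) (kiselman_eval m 1)
    (kiselman_gen (Suc m) (Suc m))"
proof (intro idempotent_doubling.intro idempotent_doubling_axioms.intro ring_kiselman_algebra
    kiselman_algebra_incl_hom kiselman_eval_hom kiselman_eval_incl kiselman_gen_closed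
    kiselman_absorb_left_algebra kiselman_absorb_right_algebra)
  show "kiselman_eval m (0::'k) (kiselman_gen (Suc m) (Suc m)) = \<zero>\<^bsub>kiselman_algebra m\<^esub>"
    by (simp only: kiselman_eval_gen kiselman_algebra_def monoid_algebra_simps single_zero)
  show "kiselman_eval m (1::'k) (kiselman_gen (Suc m) (Suc m)) = \<one>\<^bsub>kiselman_algebra m\<^esub>"
    by (simp only: kiselman_eval_gen kiselman_algebra_def monoid_algebra_simps)
qed simp_all


section \<open>The idempotents of Kiselman's semigroup algebra\<close>

text \<open>A new maximum goes to the end of the sorted list. Since \<open>kiselman_idem\<close>
  reverses the list of X but not that of the complement, a_n becomes the first factor if n is in X,
  and e - a_n the last one otherwise.\<close>

lemma sorted_list_of_set_snoc:
  fixes n :: "'a::linorder"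
  assumes "finite S" "\<And>x. x \<in> S \<Longrightarrow> x < n"
  shows "sorted_list_of_set (insert n S) = sorted_list_of_set S @ [n]"
proof -
  have "n \<notin> S" using assms(2) by blast
  then show ?thesis
    using assms by (simp add: sorted_insort_is_snoc less_imp_le)
qed

section \<open>Recursion of the idempotents in the number of generators\<close>

lemma kiselman_idem_factors_closed:
  assumes "X \<subseteq> {1..m}"
  shows "set (map (kiselman_gen m) (rev (sorted_list_of_set X)) @
       map (\<lambda>j. \<one>\<^bsub>kiselman_algebra m\<^esub> \<ominus>\<^bsub>kiselman_algebra m\<^esub> kiselman_gen m j)
         (sorted_list_of_set ({1..m} - X))) \<subseteq> carrier (kiselman_algebra m)"
proof -
  interpret ring "kiselman_algebra m :: (nat list set \<Rightarrow>\<^sub>0 'a) ring" by (rule ring_kiselman_algebra)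
  have "finite X" using assms finite_subset by blast
  then show ?thesis using assms by (auto intro!: minus_closed kiselman_gen_closed)
qed

lemma kiselman_idem_closed:
  assumes "X \<subseteq> {1..m}"
  shows "kiselman_idem m X \<in> carrier (kiselman_algebra m)"
proof -
  interpret ring "kiselman_algebra m :: (nat list set \<Rightarrow>\<^sub>0 'a) ring" by (rule ring_kiselman_algebra)
  show ?thesis
    unfolding kiselman_idem_def Let_def
    by (rule foldr_mult_closed[OF kiselman_idem_factors_closed[OF assms] one_closed])
qed

text \<open>The inclusion acts factor by factor. The complement is still taken in
  \<open>{1..m}\<close>, so the image differs from \<open>kiselman_idem n X\<close> by the factors
  with index above m.\<close>

lemma kiselman_algebra_incl_idem:
  assumes "m \<le> n" "X \<subseteq> {1..m}"
  shows "kiselman_algebra_incl n (kiselman_idem m X)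
    = foldr (mult (kiselman_algebra n)) (map (kiselman_gen n) (rev (sorted_list_of_set X)) @
       map (\<lambda>j. \<one>\<^bsub>kiselman_algebra n\<^esub> \<ominus>\<^bsub>kiselman_algebra n\<^esub> kiselman_gen n j)
         (sorted_list_of_set ({1..m} - X))) \<one>\<^bsub>kiselman_algebra n\<^esub>"
proof -
  let ?A = "\<lambda>m. kiselman_algebra m :: (nat list set \<Rightarrow>\<^sub>0 'a) ring"
  interpret ring "?A m" by (rule ring_kiselman_algebra)
  have hom: "kiselman_algebra_incl n \<in> ring_hom (?A m) (?A n)"
    by (rule kiselman_algebra_incl_hom[OF assms(1)])
  have fin: "finite X" using assms finite_subset by blast
  have gen: "kiselman_algebra_incl n (kiselman_gen m j) = (kiselman_gen n j :: nat list set \<Rightarrow>\<^sub>0 'a)"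
    if "j \<in> {1..m}" for j
    using assms(1) that by (rule kiselman_algebra_incl_gen)
  have "kiselman_algebra_incl n (\<one>\<^bsub>?A m\<^esub> \<ominus>\<^bsub>?A m\<^esub> kiselman_gen m j) = \<one>\<^bsub>?A n\<^esub> \<ominus>\<^bsub>?A n\<^esub> kiselman_gen n j"
    if "j \<in> {1..m}" for j
    using ring_hom_minus[OF ring_kiselman_algebra ring_kiselman_algebra hom one_closed
      kiselman_gen_closed[OF that]] gen[OF that]
    by (simp add: ring_hom_one[OF hom])
  then have map: "map (kiselman_algebra_incl n) (map (kiselman_gen m) (rev (sorted_list_of_set X)) @
       map (\<lambda>j. \<one>\<^bsub>?A m\<^esub> \<ominus>\<^bsub>?A m\<^esub> kiselman_gen m j) (sorted_list_of_set ({1..m} - X)))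
    = map (kiselman_gen n) (rev (sorted_list_of_set X)) @
       map (\<lambda>j. \<one>\<^bsub>?A n\<^esub> \<ominus>\<^bsub>?A n\<^esub> kiselman_gen n j) (sorted_list_of_set ({1..m} - X))"
    using assms(2) fin gen by auto
  show ?thesis
    unfolding kiselman_idem_def Let_def map
      ring_hom_foldr_mult[OF ring_kiselman_algebra hom kiselman_idem_factors_closed[OF assms(2)]] ..
qed

lemma kiselman_idem_Suc_insert:
  assumes "X \<subseteq> {1..m}"
  shows "kiselman_idem (Suc m) (insert (Suc m) X)
    = kiselman_gen (Suc m) (Suc m) \<otimes>\<^bsub>kiselman_algebra (Suc m)\<^esub>
        kiselman_algebra_incl (Suc m) (kiselman_idem m X)"
proof -
  have "finite X" using assms finite_subset by blast
  then have "sorted_list_of_set (insert (Suc m) X) = sorted_list_of_set X @ [Suc m]"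
    by (rule sorted_list_of_set_snoc) (use assms in auto)
  moreover have "{1..Suc m} - insert (Suc m) X = {1..m} - X"
    by auto
  ultimately show ?thesis
    unfolding kiselman_algebra_incl_idem[OF le_SucI[OF order.refl] assms]
    by (simp add: kiselman_idem_def Let_def)
qed

lemma kiselman_idem_Suc:
  assumes "X \<subseteq> {1..m}"
  defines "A \<equiv> kiselman_algebra (Suc m)"
  shows "kiselman_idem (Suc m) X
    = kiselman_algebra_incl (Suc m) (kiselman_idem m X)
        \<otimes>\<^bsub>A\<^esub> (\<one>\<^bsub>A\<^esub> \<ominus>\<^bsub>A\<^esub> kiselman_gen (Suc m) (Suc m))"
proof -
  interpret A: ring A unfolding A_def by (rule ring_kiselman_algebra)
  have X: "X \<subseteq> {1..Suc m}" using assms(1) by auto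
  have "{1..Suc m} - X = insert (Suc m) ({1..m} - X)"
    using assms(1) by auto
  moreover have "sorted_list_of_set (insert (Suc m) ({1..m} - X))
      = sorted_list_of_set ({1..m} - X) @ [Suc m]"
    by (rule sorted_list_of_set_snoc) auto
  ultimately have *: "sorted_list_of_set ({1..Suc m} - X) = sorted_list_of_set ({1..m} - X) @ [Suc m]"
    by simp
  have gen: "kiselman_gen (Suc m) (Suc m) \<in> carrier A"
    unfolding A_def by (rule kiselman_gen_closed) simp
  \<comment> \<open>By \<open>*\<close> these are the factors of
    \<open>kiselman_idem (Suc m) X\<close> except the last, so their closure is inherited from the
    full list.\<close>
  have car: "set (map (kiselman_gen (Suc m)) (rev (sorted_list_of_set X)) @
       map (\<lambda>j. \<one>\<^bsub>A\<^esub> \<ominus>\<^bsub>A\<^esub> kiselman_gen (Suc m) j) (sorted_list_of_set ({1..m} - X))) \<subseteq> carrier A"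
    using kiselman_idem_factors_closed[OF X] unfolding * A_def by auto
  show ?thesis
    unfolding A_def[symmetric] kiselman_algebra_incl_idem[OF le_SucI[OF order.refl] assms(1)]
    using A.foldr_mult_one[OF car, of "\<one>\<^bsub>A\<^esub> \<ominus>\<^bsub>A\<^esub> kiselman_gen (Suc m) (Suc m)"] gen *
    by (simp add: kiselman_idem_def Let_def A_def[symmetric])
qed

section \<open>Induction on the number of generators\<close>

lemma Pow_atLeastAtMost_Suc:
  "Pow {1..Suc m} = Pow {1..m} \<union> insert (Suc m) ` Pow {1..m}"
  by (simp add: atLeastAtMostSuc_conv Pow_insert)

lemma subset_atLeastAtMost_Suc_cases:
  assumes "X \<subseteq> {1..Suc m}"
  obtains "X \<subseteq> {1..m}" | Y where "Y \<subseteq> {1..m}" "X = insert (Suc m) Y"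
  using assms Pow_atLeastAtMost_Suc[of m] by blast

text \<open>Without generators the empty word is the only word, so the algebra is a copy of the
  field. It has no zero divisors, which excludes a splitting of 1 into nonzero orthogonal
  summands.\<close>

lemma primitive_idempotent_kiselman_0:
  "primitive_idempotent (kiselman_algebra 0 :: (nat list set \<Rightarrow>\<^sub>0 'k::field) ring)
    \<one>\<^bsub>kiselman_algebra 0\<^esub>"
proof -
  let ?A = "kiselman_algebra 0 :: (nat list set \<Rightarrow>\<^sub>0 'k) ring"
  interpret ring ?A by (rule ring_kiselman_algebra)
  have scalar: "\<exists>c. f = Poly_Mapping.single \<one>\<^bsub>kiselman 0\<^esub> c" if "f \<in> carrier ?A" for f
    using that
  proof (induction f rule: kiselman_algebra_induct)
    case zero
    show ?case by (metis single_zero)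
  next
    case (single w a)
    then show ?case by (auto simp: one_kiselman)
  next
    case (add f g)
    then show ?case by (metis single_add)
  qed
  have one: "\<one>\<^bsub>kiselman 0\<^esub> \<otimes>\<^bsub>kiselman 0\<^esub> \<one>\<^bsub>kiselman 0\<^esub> = \<one>\<^bsub>kiselman 0\<^esub>"
    unfolding one_kiselman by (subst mult_kiselman) simp_all
  have "f = \<zero>\<^bsub>?A\<^esub> \<or> g = \<zero>\<^bsub>?A\<^esub>"
    if f: "f \<in> carrier ?A" and g: "g \<in> carrier ?A" and fg: "f \<otimes>\<^bsub>?A\<^esub> g = \<zero>\<^bsub>?A\<^esub>" for f g
  proof -
    obtain c d where cd: "f = Poly_Mapping.single \<one>\<^bsub>kiselman 0\<^esub> c" "g = Poly_Mapping.single \<one>\<^bsub>kiselman 0\<^esub> d"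
      using scalar f g by blast
    have "Poly_Mapping.single \<one>\<^bsub>kiselman 0\<^esub> (c * d) = 0"
      using fg by (simp add: cd kiselman_algebra_def monoid_algebra_mult_single one monoid_algebra_simps)
    then have "c * d = 0" by (metis lookup_single_eq lookup_zero)
    then show ?thesis by (auto simp: cd kiselman_algebra_def monoid_algebra_simps)
  qed
  moreover have "\<one>\<^bsub>?A\<^esub> \<noteq> \<zero>\<^bsub>?A\<^esub>"
    by (simp add: kiselman_algebra_def monoid_algebra_simps)
       (metis lookup_single_eq lookup_zero zero_neq_one)
  ultimately show ?thesis
    unfolding primitive_idempotent_def idempotent_def by auto
qed

lemma kiselman_idem_0: "kiselman_idem 0 {} = \<one>\<^bsub>kiselman_algebra 0\<^esub>"
  by (simp add: kiselman_idem_def)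

lemma primitive_idempotent_kiselman_idem:
  "X \<subseteq> {1..n} \<Longrightarrow>
    primitive_idempotent (kiselman_algebra n :: (nat list set \<Rightarrow>\<^sub>0 'k::field) ring) (kiselman_idem n X)"
proof (induction n arbitrary: X)
  case 0
  then show ?case by (simp add: kiselman_idem_0 primitive_idempotent_kiselman_0)
next
  case (Suc m)
  note D = kiselman_doubling[of m, where 'k = 'k]
  show ?case
    using Suc.prems
  proof (cases rule: subset_atLeastAtMost_Suc_cases)
    case 1
    then show ?thesis
      using idempotent_doubling.primitive_b[OF D Suc.IH[OF 1]] by (simp add: kiselman_idem_Suc)
  next
    case (2 Y)
    then show ?thesis
      using idempotent_doubling.primitive_a[OF D Suc.IH[OF 2(1)]]
      by (simp add: kiselman_idem_Suc_insert)
  qed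
qed

text \<open>If exactly one of X and Y contains the last index, the product vanishes by
  \<open>mult_ab\<close> or \<open>mult_ba\<close>. Otherwise X and Y still differ below that index,
  and \<open>mult_aa\<close> or \<open>mult_bb\<close> reduces to the induction hypothesis.\<close>

lemma kiselman_idem_orthogonal:
  "X \<subseteq> {1..n} \<Longrightarrow> Y \<subseteq> {1..n} \<Longrightarrow> X \<noteq> Y \<Longrightarrow>
    kiselman_idem n X \<otimes>\<^bsub>kiselman_algebra n\<^esub> kiselman_idem n Y
      = \<zero>\<^bsub>kiselman_algebra n :: (nat list set \<Rightarrow>\<^sub>0 'k::comm_ring_1) ring\<^esub>"
proof (induction n arbitrary: X Y)
  case 0
  then show ?case by simp
next
  case (Suc m)
  interpret D: idempotent_doubling "kiselman_algebra (Suc m) :: (nat list set \<Rightarrow>\<^sub>0 'k) ring"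
    "kiselman_algebra m" "kiselman_algebra_incl (Suc m)" "kiselman_eval m 0" "kiselman_eval m 1"
    "kiselman_gen (Suc m) (Suc m)"
    by (rule kiselman_doubling)
  from Suc.prems(1) show ?case
  proof (cases rule: subset_atLeastAtMost_Suc_cases)
    case X: 1
    from Suc.prems(2) show ?thesis
    proof (cases rule: subset_atLeastAtMost_Suc_cases)
      case 1
      then show ?thesis
        using X Suc.IH[OF X 1 Suc.prems(3)]
        by (simp add: kiselman_idem_Suc D.mult_bb kiselman_idem_closed D.emb_zero D.b)
    next
      case (2 Y')
      then show ?thesis
        using X by (simp add: kiselman_idem_Suc kiselman_idem_Suc_insert D.mult_ba kiselman_idem_closed)
    qed
  next
    case X: (2 X')
    from Suc.prems(2) show ?thesis
    proof (cases rule: subset_atLeastAtMost_Suc_cases)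
      case 1
      then show ?thesis
        using X by (simp add: kiselman_idem_Suc kiselman_idem_Suc_insert D.mult_ab kiselman_idem_closed)
    next
      case (2 Y')
      then have "X' \<noteq> Y'" using X Suc.prems(3) by blast
      then show ?thesis
        using X 2 Suc.IH[of X' Y']
        by (simp add: kiselman_idem_Suc_insert D.mult_aa kiselman_idem_closed D.emb_zero D.a)
    qed
  qed
qed

lemma kiselman_idem_sum:
  "\<one>\<^bsub>kiselman_algebra n :: (nat list set \<Rightarrow>\<^sub>0 'k::comm_ring_1) ring\<^esub>
    = (\<Oplus>\<^bsub>kiselman_algebra n\<^esub>X\<in>Pow {1..n}. kiselman_idem n X)"
proof (induction n)
  case 0
  interpret ring "kiselman_algebra 0 :: (nat list set \<Rightarrow>\<^sub>0 'k) ring" by (rule ring_kiselman_algebra)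
  show ?case by (simp add: kiselman_idem_0)
next
  case (Suc m)
  interpret D: idempotent_doubling "kiselman_algebra (Suc m) :: (nat list set \<Rightarrow>\<^sub>0 'k) ring"
    "kiselman_algebra m" "kiselman_algebra_incl (Suc m)" "kiselman_eval m 0" "kiselman_eval m 1"
    "kiselman_gen (Suc m) (Suc m)"
    by (rule kiselman_doubling)
  let ?A = "kiselman_algebra (Suc m) :: (nat list set \<Rightarrow>\<^sub>0 'k) ring"
  let ?I = "Pow {1..m}"
  have closed: "kiselman_idem (Suc m) X \<in> carrier ?A"
    "kiselman_idem (Suc m) (insert (Suc m) X) \<in> carrier ?A" if "X \<in> ?I" for X
    by (rule kiselman_idem_closed, use that in auto)+
  have inj: "inj_on (insert (Suc m)) ?I"
    by (rule inj_onI) (auto simp: set_eq_iff, (metis Suc_n_not_le_n atLeastAtMost_iff subsetD)+)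
  \<comment> \<open>Separate the subsets by whether they contain \<open>Suc m\<close>; the recursion
    turns the two partial sums into those of \<open>finsum_doubling\<close>.\<close>
  have "(\<Oplus>\<^bsub>?A\<^esub>X\<in>Pow {1..Suc m}. kiselman_idem (Suc m) X)
      = (\<Oplus>\<^bsub>?A\<^esub>X\<in>?I. kiselman_idem (Suc m) X)
        \<oplus>\<^bsub>?A\<^esub> (\<Oplus>\<^bsub>?A\<^esub>X\<in>insert (Suc m) ` ?I. kiselman_idem (Suc m) X)"
    unfolding Pow_atLeastAtMost_Suc
    by (rule D.R.finsum_Un_disjoint) (use closed in auto)
  also have "(\<Oplus>\<^bsub>?A\<^esub>X\<in>insert (Suc m) ` ?I. kiselman_idem (Suc m) X)
      = (\<Oplus>\<^bsub>?A\<^esub>X\<in>?I. kiselman_idem (Suc m) (insert (Suc m) X))"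
    by (rule D.R.finsum_reindex[OF _ inj]) (use closed in auto)
  also have "\<dots> = (\<Oplus>\<^bsub>?A\<^esub>X\<in>?I. kiselman_gen (Suc m) (Suc m) \<otimes>\<^bsub>?A\<^esub>
      kiselman_algebra_incl (Suc m) (kiselman_idem m X))"
    by (rule D.R.finsum_cong')
      (auto simp: kiselman_idem_Suc_insert D.a D.emb_closed kiselman_idem_closed)
  also have "(\<Oplus>\<^bsub>?A\<^esub>X\<in>?I. kiselman_idem (Suc m) X)
      = (\<Oplus>\<^bsub>?A\<^esub>X\<in>?I. kiselman_algebra_incl (Suc m) (kiselman_idem m X) \<otimes>\<^bsub>?A\<^esub> D.b)"
    by (rule D.R.finsum_cong')
      (auto simp: kiselman_idem_Suc D.a D.emb_closed kiselman_idem_closed)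
  also have "\<dots> \<oplus>\<^bsub>?A\<^esub> (\<Oplus>\<^bsub>?A\<^esub>X\<in>?I. kiselman_gen (Suc m) (Suc m) \<otimes>\<^bsub>?A\<^esub>
      kiselman_algebra_incl (Suc m) (kiselman_idem m X)) = \<one>\<^bsub>?A\<^esub>"
    by (rule D.finsum_doubling[symmetric]) (use Suc.IH kiselman_idem_closed in auto)
  finally show ?case ..
qed

lemma kiselman_idem_range_Suc:
  fixes m :: nat
  defines "A \<equiv> kiselman_algebra (Suc m)"
    and "E \<equiv> (\<lambda>Y. kiselman_algebra_incl (Suc m) (kiselman_idem m Y)) ` Pow {1..m}"
  shows "kiselman_idem (Suc m) ` Pow {1..Suc m}
    = (\<lambda>y. kiselman_gen (Suc m) (Suc m) \<otimes>\<^bsub>A\<^esub> y) ` E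
      \<union> (\<lambda>y. y \<otimes>\<^bsub>A\<^esub> (\<one>\<^bsub>A\<^esub> \<ominus>\<^bsub>A\<^esub> kiselman_gen (Suc m) (Suc m))) ` E"
  unfolding Pow_atLeastAtMost_Suc image_Un E_def A_def image_image
  \<comment> \<open>The power set lists the subsets without \<open>Suc m\<close> first, the claim
    lists the products with a_n on the left first; the swap aligns the two unions.\<close>
  by (subst Un_commute, intro arg_cong2[where f = "(\<union>)"] image_cong refl)
    (simp_all add: kiselman_idem_Suc kiselman_idem_Suc_insert)

theorem proposition38:
  fixes n :: nat
  assumes "n \<ge> 1"
  shows "let A = (kiselman_algebra n :: (nat list set \<Rightarrow>\<^sub>0 'k::field) ring);
             E = kiselman_idem n ` Pow {1..n};
             E' = (\<lambda>Y. kiselman_algebra_incl n (kiselman_idem (n - 1) Y)) ` Pow {1..n - 1}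
         in E = (\<lambda>y. kiselman_gen n n \<otimes>\<^bsub>A\<^esub> y) ` E'
                \<union> (\<lambda>y. y \<otimes>\<^bsub>A\<^esub> (\<one>\<^bsub>A\<^esub> \<ominus>\<^bsub>A\<^esub> kiselman_gen n n)) ` E'
          \<and> (\<forall>X\<subseteq>{1..n}. primitive_idempotent A (kiselman_idem n X))
          \<and> (\<forall>X\<subseteq>{1..n}. \<forall>Y\<subseteq>{1..n}. X \<noteq> Y \<longrightarrow>
                kiselman_idem n X \<otimes>\<^bsub>A\<^esub> kiselman_idem n Y = \<zero>\<^bsub>A\<^esub>)
          \<and> \<one>\<^bsub>A\<^esub> = (\<Oplus>\<^bsub>A\<^esub>X\<in>Pow {1..n}. kiselman_idem n X)"
proof -
  \<comment> \<open>Positivity of n makes \<open>n - 1\<close> a true predecessor, so that the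
    statements for \<open>Suc m\<close> apply.\<close>
  obtain m where n: "n = Suc m" using assms by (cases n) auto
  show ?thesis
    unfolding Let_def n diff_Suc_1
    by (intro conjI allI impI kiselman_idem_range_Suc primitive_idempotent_kiselman_idem
        kiselman_idem_orthogonal kiselman_idem_sum)
qed

end
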